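(* Let $F$ be a field with $\operatorname{char}(F)=2$. If every set of three quaternion algebras over $F$ is linked, then $I_q^3F=0$.
   Context: Let $F$ be a field of characteristic $2$. For $\alpha\in F$, $\beta\in F^\times$, the quaternion algebra $[\alpha,\beta)_{2,F}$ is the $F$-algebra generated by $x,y$ with relations $x^2+x=\alpha$, $y^2=\beta$, $yxy^{-1}=x+1$; quaternion algebras over $F$ are the algebras of this form (the split algebra is included). Its norm form is the quadratic $2$-fold Pfister form $\langle\langle\beta,\alpha]]=\langle 1,\beta\rangle\otimes[1,\alpha]$, where $[1,\alpha]$ is the quadratic form $x^2+xy+\alpha y^2$ and $\langle 1,\beta\rangle$ is a diagonal bilinear form. This gives a bijection between isomorphism classes of quaternion $F$-algebras and isometry classes of quadratic $2$-fold Pfister forms over $F$. A bilinear $1$-fold Pfister form is a form $\langle\langle a\rangle\rangle=\langle 1,a\rangle$ with $a\in F^\times$; a quadratic $1$-fold Pfister form is a form $[1,b]$ with $b\in F$. A set of quaternion algebras $Q_1,\dots,Q_m$ (repetitions allowed) with norm forms $\varphi_1,\dots,\varphi_m$ is linked if the forms $\varphi_i$ have a common quadratic or bilinear $1$-fold Pfister factor, that is: either there are a quadratic $1$-fold Pfister form $\phi$ and bilinear $1$-fold Pfister forms $B_i$ with $\varphi_i\cong B_i\otimes\phi$ for all $i$, or there are a bilinear $1$-fold Pfister form $B$ and quadratic $1$-fold Pfister forms $\phi_i$ with $\varphi_i\cong B\otimes\phi_i$ for all $i$. In terms of algebras, this is the condition that the $Q_i$ share a common maximal subfield (a separable, respectively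 inseparable, quadratic field extension of $F$). $I_qF$ is the group of Witt classes of nonsingular quadratic forms over $F$ under orthogonal sum. $I_q^3F$ is its subgroup generated by the classes of scalar multiples of quadratic $3$-fold Pfister forms $\langle\langle a,b,c]]=\langle 1,a\rangle\otimes\langle 1,b\rangle\otimes[1,c]$, $a,b\in F^\times$, $c\in F$. *)

theory Defs
  imports "Jordan_Normal_Form.VS_Connect" "HOL-Algebra.Generated_Groups"
begin

section \<open>Quadratic forms\<close>

text \<open>A quadratic form of dimension \<open>n\<close> is given by a function on the coordinate space
  \<open>carrier_vec n\<close>; its values elsewhere carry no meaning and are never inspected.\<close>

datatype 'a qform = QForm (qdim: nat) (qval: "'a vec \<Rightarrow> 'a")

definition polar :: "'a::field qform \<Rightarrow> 'a vec \<Rightarrow> 'a vec \<Rightarrow> 'a" where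
  "polar q v w = qval q (v + w) - qval q v - qval q w"

definition quadratic_form :: "'a::field qform \<Rightarrow> bool" where
  "quadratic_form q \<longleftrightarrow>
    (\<forall>c. \<forall>v \<in> carrier_vec (qdim q). qval q (c \<cdot>\<^sub>v v) = c\<^sup>2 * qval q v) \<and>
    (\<forall>u \<in> carrier_vec (qdim q). \<forall>v \<in> carrier_vec (qdim q). \<forall>w \<in> carrier_vec (qdim q).
       polar q (u + v) w = polar q u w + polar q v w) \<and>
    (\<forall>c. \<forall>v \<in> carrier_vec (qdim q). \<forall>w \<in> carrier_vec (qdim q).
       polar q (c \<cdot>\<^sub>v v) w = c * polar q v w)"

text \<open>Nonsingular means that the polar form has trivial radical; in characteristic 2 this
  forces even dimension.\<close>

definition nonsingular :: "'a::field qform \<Rightarrow> bool" where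
  "nonsingular q \<longleftrightarrow> quadratic_form q \<and>
    (\<forall>v \<in> carrier_vec (qdim q).
       (\<forall>w \<in> carrier_vec (qdim q). polar q v w = 0) \<longrightarrow> v = 0\<^sub>v (qdim q))"

definition isometric :: "'a::field qform \<Rightarrow> 'a qform \<Rightarrow> bool" (infix \<open>\<cong>\<^sub>q\<close> 50) where
  "q \<cong>\<^sub>q r \<longleftrightarrow> qdim q = qdim r \<and>
    (\<exists>T \<in> carrier_mat (qdim q) (qdim q). invertible_mat T \<and>
       (\<forall>v \<in> carrier_vec (qdim q). qval r (T *\<^sub>v v) = qval q v))"

definition zero_form :: "'a::field qform" where
  "zero_form = QForm 0 (\<lambda>_. 0)"

definition orth_sum :: "'a::field qform \<Rightarrow> 'a qform \<Rightarrow> 'a qform" (infixr \<open>\<bottom>\<^sub>q\<close> 65) where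
  "q \<bottom>\<^sub>q r = QForm (qdim q + qdim r)
     (\<lambda>v. qval q (vec_first v (qdim q)) + qval r (vec_last v (qdim r)))"

definition scale_form :: "'a::field \<Rightarrow> 'a qform \<Rightarrow> 'a qform" where
  "scale_form c q = QForm (qdim q) (\<lambda>v. c * qval q v)"

text \<open>The diagonal bilinear form \<open>\<langle>b\<^sub>1, \<dots>, b\<^sub>k\<rangle>\<close> is represented by the list of its entries, and
  \<open>\<langle>b\<^sub>1, \<dots>, b\<^sub>k\<rangle> \<otimes> q = b\<^sub>1 q \<bottom> \<dots> \<bottom> b\<^sub>k q\<close>.\<close>

definition diag_tensor :: "'a::field list \<Rightarrow> 'a qform \<Rightarrow> 'a qform" (infixr \<open>\<otimes>\<^sub>q\<close> 70) where
  "bs \<otimes>\<^sub>q q = foldr (\<lambda>b r. scale_form b q \<bottom>\<^sub>q r) bs zero_form"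


section \<open>Pfister forms\<close>

definition bilinear_pfister1 :: "'a::field \<Rightarrow> 'a list" where
  "bilinear_pfister1 a = [1, a]"

definition quad_pfister1 :: "'a::field \<Rightarrow> 'a qform" where
  "quad_pfister1 c = QForm 2 (\<lambda>v. (v $ 0)\<^sup>2 + v $ 0 * v $ 1 + c * (v $ 1)\<^sup>2)"

definition quad_pfister2 :: "'a::field \<Rightarrow> 'a \<Rightarrow> 'a qform" where
  "quad_pfister2 b c = bilinear_pfister1 b \<otimes>\<^sub>q quad_pfister1 c"

definition quad_pfister3 :: "'a::field \<Rightarrow> 'a \<Rightarrow> 'a \<Rightarrow> 'a qform" where
  "quad_pfister3 a b c = bilinear_pfister1 a \<otimes>\<^sub>q bilinear_pfister1 b \<otimes>\<^sub>q quad_pfister1 c"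


section \<open>Quaternion algebras\<close>

text \<open>The library locale \<open>algebra\<close> covers commutative algebras only, hence the next definition
  of an associative unital algebra over the field given by the type.\<close>

definition assoc_algebra :: "('a::field, 'b) module \<Rightarrow> bool" where
  "assoc_algebra A \<longleftrightarrow> module class_ring A \<and> ring A \<and>
    (\<forall>c. \<forall>u \<in> carrier A. \<forall>v \<in> carrier A.
       (c \<odot>\<^bsub>A\<^esub> u) \<otimes>\<^bsub>A\<^esub> v = c \<odot>\<^bsub>A\<^esub> (u \<otimes>\<^bsub>A\<^esub> v) \<and>
       u \<otimes>\<^bsub>A\<^esub> (c \<odot>\<^bsub>A\<^esub> v) = c \<odot>\<^bsub>A\<^esub> (u \<otimes>\<^bsub>A\<^esub> v))"

text \<open>\<open>A\<close> is (isomorphic to) \<open>[\<alpha>, \<beta>)\<close>. The algebra presented by \<open>x, y\<close> with these relations has the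
  basis \<open>1, x, y, xy\<close>. The basis condition thus expresses that \<open>x, y\<close> generate \<open>A\<close> and that
  there are no relations beyond the consequences of the given ones.\<close>

definition quaternion_symbol :: "('a::field, 'b) module \<Rightarrow> 'a \<Rightarrow> 'a \<Rightarrow> bool" where
  "quaternion_symbol A \<alpha> \<beta> \<longleftrightarrow> assoc_algebra A \<and> \<beta> \<noteq> 0 \<and>
    (\<exists>x \<in> carrier A. \<exists>y \<in> Units A.
       x \<otimes>\<^bsub>A\<^esub> x \<oplus>\<^bsub>A\<^esub> x = \<alpha> \<odot>\<^bsub>A\<^esub> \<one>\<^bsub>A\<^esub> \<and>
       y \<otimes>\<^bsub>A\<^esub> y = \<beta> \<odot>\<^bsub>A\<^esub> \<one>\<^bsub>A\<^esub> \<and>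
       y \<otimes>\<^bsub>A\<^esub> x \<otimes>\<^bsub>A\<^esub> inv\<^bsub>A\<^esub> y = x \<oplus>\<^bsub>A\<^esub> \<one>\<^bsub>A\<^esub> \<and>
       (\<forall>z \<in> carrier A. \<exists>!(c0, c1, c2, c3).
          z = c0 \<odot>\<^bsub>A\<^esub> \<one>\<^bsub>A\<^esub> \<oplus>\<^bsub>A\<^esub> c1 \<odot>\<^bsub>A\<^esub> x \<oplus>\<^bsub>A\<^esub> c2 \<odot>\<^bsub>A\<^esub> y \<oplus>\<^bsub>A\<^esub> c3 \<odot>\<^bsub>A\<^esub> (x \<otimes>\<^bsub>A\<^esub> y)))"

definition quaternion_algebra :: "('a::field, 'b) module \<Rightarrow> bool" where
  "quaternion_algebra A \<longleftrightarrow> (\<exists>\<alpha> \<beta>. quaternion_symbol A \<alpha> \<beta>)"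

text \<open>The norm form is determined by the algebra only up to isometry, hence a relation.\<close>

definition norm_form :: "('a::field, 'b) module \<Rightarrow> 'a qform \<Rightarrow> bool" where
  "norm_form A \<phi> \<longleftrightarrow> (\<exists>\<alpha> \<beta>. quaternion_symbol A \<alpha> \<beta> \<and> \<phi> = quad_pfister2 \<beta> \<alpha>)"

definition common_pfister_factor :: "'a::field qform list \<Rightarrow> bool" where
  "common_pfister_factor \<phi>s \<longleftrightarrow>
    (\<exists>b. \<forall>\<phi> \<in> set \<phi>s. \<exists>a. a \<noteq> 0 \<and> \<phi> \<cong>\<^sub>q bilinear_pfister1 a \<otimes>\<^sub>q quad_pfister1 b) \<or>
    (\<exists>a. a \<noteq> 0 \<and> (\<forall>\<phi> \<in> set \<phi>s. \<exists>b. \<phi> \<cong>\<^sub>q bilinear_pfister1 a \<otimes>\<^sub>q quad_pfister1 b))"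

definition linked :: "('a::field, 'b) module list \<Rightarrow> bool" where
  "linked Qs \<longleftrightarrow> (\<exists>\<phi>s. list_all2 norm_form Qs \<phi>s \<and> common_pfister_factor \<phi>s)"


section \<open>The quadratic Witt group\<close>

definition hyperbolic_plane :: "'a::field qform" where
  "hyperbolic_plane = QForm 2 (\<lambda>v. v $ 0 * v $ 1)"

primrec hyperbolic :: "nat \<Rightarrow> 'a::field qform" where
  "hyperbolic 0 = zero_form"
| "hyperbolic (Suc k) = hyperbolic_plane \<bottom>\<^sub>q hyperbolic k"

definition witt_equiv :: "'a::field qform \<Rightarrow> 'a qform \<Rightarrow> bool" where
  "witt_equiv q r \<longleftrightarrow> (\<exists>i j. q \<bottom>\<^sub>q hyperbolic i \<cong>\<^sub>q r \<bottom>\<^sub>q hyperbolic j)"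

definition witt_class :: "'a::field qform \<Rightarrow> 'a qform set" where
  "witt_class q = {r. nonsingular r \<and> witt_equiv q r}"

definition Iq :: "'a::field qform set monoid" where
  "Iq = \<lparr>carrier = witt_class ` {q. nonsingular q},
         mult = (\<lambda>X Y. \<Union>q \<in> X. \<Union>r \<in> Y. witt_class (q \<bottom>\<^sub>q r)),
         one = witt_class zero_form\<rparr>"

definition Iq3 :: "'a::field qform set set" where
  "Iq3 = generate Iq {witt_class (scale_form d (quad_pfister3 a b c)) |a b c d.
                        a \<noteq> 0 \<and> b \<noteq> 0 \<and> d \<noteq> 0}"

end

theory Submission
  imports Defs "Jordan_Normal_Form.Determinant"
begin

text \<open>
  To algebras \<open>Q, Q'\<close> with a common separable slot, \<open>Q = [e, f)\<close> and \<open>Q' = [e, f')\<close>, attach the class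
  \<open>\<pi>(Q, Q') = \<langle>\<langle>f, f', e]]\<close>. It is the sum of the classes of the norm forms of \<open>Q\<close>, \<open>Q'\<close> and
  \<open>[e, ff')\<close>, and the last one is determined up to isometry by the first two, so it does not depend
  on \<open>e\<close>. It vanishes if \<open>Q, Q'\<close> also have a common inseparable slot. Triple linkage makes \<open>\<pi>\<close>
  biadditive as soon as one of the pairs involved has \<open>\<pi> = 0\<close>.

  Write \<open>((t, g)) = [tg, g)\<close>; this symbol is symmetric and biadditive. Put \<open>t = c/b\<close> and \<open>s = c\<^sup>2/a\<close>.
  Then \<open>[c, b) = ((t, b))\<close>, \<open>[c, a) = ((s, a))\<close> and \<open>((s, b)) = [c\<^sup>2b/a, b) = [c\<^sup>2b/a, a)\<close>. As
  \<open>((s, b))\<close> shares the slot \<open>b\<close> with \<open>((t, b))\<close>, the class \<open>\<langle>\<langle>a, b, c]] = \<pi>(((t, b)), ((s, a)))\<close> equals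
  \<open>\<pi>(((t, b)), ((s, a + b)))\<close>. Now \<open>((t, b)) = ((t, a)) + ((t, a + b))\<close>; the summand \<open>((t, a + b))\<close>
  shares the slot \<open>a + b\<close> with \<open>((s, a + b))\<close>, and \<open>((t, a))\<close> shares the slot \<open>a\<close> with
  \<open>((s, a + b)) = [s(a + b), a)\<close>. Hence \<open>\<langle>\<langle>a, b, c]] = 0\<close>. Should
  one of the two triples to which linkage is applied share an inseparable slot instead, then the
  relevant \<open>\<pi>\<close> vanishes at once.
\<close>

section \<open>Isometries\<close>

text \<open>Isometries are given below as pairs of mutually inverse linear maps, which are easier to
  compose and to split than matrices; \<open>isometricI\<close> and \<open>isometricE\<close>
  translate to and from the matrix form.\<close>

definition linear_fun :: "nat \<Rightarrow> nat \<Rightarrow> ('a::field vec \<Rightarrow> 'a vec) \<Rightarrow> bool" where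
  "linear_fun n m f \<longleftrightarrow> (\<forall>v \<in> carrier_vec n. f v \<in> carrier_vec m) \<and>
    (\<forall>v \<in> carrier_vec n. \<forall>w \<in> carrier_vec n. f (v + w) = f v + f w) \<and>
    (\<forall>c. \<forall>v \<in> carrier_vec n. f (c \<cdot>\<^sub>v v) = c \<cdot>\<^sub>v f v)"

definition linear_form :: "nat \<Rightarrow> ('a::field vec \<Rightarrow> 'a) \<Rightarrow> bool" where
  "linear_form n f \<longleftrightarrow>
    (\<forall>v \<in> carrier_vec n. \<forall>w \<in> carrier_vec n. f (v + w) = f v + f w) \<and>
    (\<forall>c. \<forall>v \<in> carrier_vec n. f (c \<cdot>\<^sub>v v) = c * f v)"

lemma linear_form_sum:
  assumes f: "linear_form n f" and A: "finite A" and u: "\<And>i. i \<in> A \<Longrightarrow> u i \<in> carrier_vec n"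
  shows "f (finsum_vec TYPE('a) n u A) = (\<Sum>i\<in>A. f (u i :: 'a::field vec))"
  using A u
proof (induction A rule: finite_induct)
  case empty
  have "f (0 \<cdot>\<^sub>v 0\<^sub>v n) = 0 * f (0\<^sub>v n)"
    using f zero_carrier_vec unfolding linear_form_def by metis
  moreover have "0 \<cdot>\<^sub>v 0\<^sub>v n = (0\<^sub>v n :: 'a vec)" by (rule eq_vecI) auto
  ultimately show ?case by (simp add: finsum_vec_empty)
next
  case (insert x A)
  then have "u x \<in> carrier_vec n" "finsum_vec TYPE('a) n u A \<in> carrier_vec n"
    by (auto intro!: finsum_vec_closed)
  with f have "f (u x + finsum_vec TYPE('a) n u A) = f (u x) + f (finsum_vec TYPE('a) n u A)"
    unfolding linear_form_def by blast
  with insert show ?case by (subst finsum_vec_insert) auto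
qed

lemma linear_form_unit:
  fixes v :: "'a::field vec"
  assumes f: "linear_form n f" and v: "v \<in> carrier_vec n"
  shows "f v = (\<Sum>i<n. v $ i * f (unit_vec n i))"
proof -
  have "v = finsum_vec TYPE('a) n (\<lambda>i. v $ i \<cdot>\<^sub>v unit_vec n i) {..<n}"
  proof (rule eq_vecI)
    fix j assume "j < dim_vec (finsum_vec TYPE('a) n (\<lambda>i. v $ i \<cdot>\<^sub>v unit_vec n i) {..<n})"
    moreover have *: "finsum_vec TYPE('a) n (\<lambda>i. v $ i \<cdot>\<^sub>v unit_vec n i) {..<n} \<in> carrier_vec n"
      by (rule finsum_vec_closed) auto
    ultimately have j: "j < n" by auto
    have "finsum_vec TYPE('a) n (\<lambda>i. v $ i \<cdot>\<^sub>v unit_vec n i) {..<n} $ j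
        = (\<Sum>i<n. (v $ i \<cdot>\<^sub>v unit_vec n i) $ j)"
      by (rule index_finsum_vec) (use j in auto)
    also have "\<dots> = (\<Sum>i<n. if i = j then v $ j else 0)"
      by (rule sum.cong) (use j in auto)
    finally show "v $ j = finsum_vec TYPE('a) n (\<lambda>i. v $ i \<cdot>\<^sub>v unit_vec n i) {..<n} $ j"
      using j by simp
  next
    have *: "finsum_vec TYPE('a) n (\<lambda>i. v $ i \<cdot>\<^sub>v unit_vec n i) {..<n} \<in> carrier_vec n"
      by (rule finsum_vec_closed) auto
    then show "dim_vec v = dim_vec (finsum_vec TYPE('a) n (\<lambda>i. v $ i \<cdot>\<^sub>v unit_vec n i) {..<n})"
      using v by (metis carrier_vecD)
  qed
  then have "f v = f (finsum_vec TYPE('a) n (\<lambda>i. v $ i \<cdot>\<^sub>v unit_vec n i) {..<n})" by simp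
  also have "\<dots> = (\<Sum>i<n. f (v $ i \<cdot>\<^sub>v unit_vec n i))"
    by (rule linear_form_sum[OF f]) auto
  also have "\<dots> = (\<Sum>i<n. v $ i * f (unit_vec n i))"
    using f unfolding linear_form_def by (intro sum.cong) auto
  finally show ?thesis .
qed

lemma linear_fun_mat:
  fixes f :: "'a::field vec \<Rightarrow> 'a vec"
  assumes f: "linear_fun n m f" and v: "v \<in> carrier_vec n"
  shows "mat m n (\<lambda>(i, j). f (unit_vec n j) $ i) *\<^sub>v v = f v"
proof (rule eq_vecI)
  fix i assume "i < dim_vec (f v)"
  then have i: "i < m" using f v unfolding linear_fun_def by auto
  have "linear_form n (\<lambda>v. f v $ i)"
    using f i unfolding linear_fun_def linear_form_def
    by (metis carrier_vecD index_add_vec(1) index_smult_vec(1))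
  from linear_form_unit[OF this v] show
    "(mat m n (\<lambda>(i, j). f (unit_vec n j) $ i) *\<^sub>v v) $ i = f v $ i"
    using i v by (simp add: scalar_prod_def atLeast0LessThan mult.commute)
qed (use f v in \<open>auto simp: linear_fun_def\<close>)

lemma eq_mat_by_vec:
  fixes A B :: "'a::field mat"
  assumes "A \<in> carrier_mat m n" "B \<in> carrier_mat m n"
    and "\<And>v. v \<in> carrier_vec n \<Longrightarrow> A *\<^sub>v v = B *\<^sub>v v"
  shows "A = B"
proof (rule eq_matI)
  fix i j assume ij: "i < dim_row B" "j < dim_col B"
  have "(A *\<^sub>v unit_vec n j) $ i = (B *\<^sub>v unit_vec n j) $ i" using assms(3) by simp
  then show "A $$ (i, j) = B $$ (i, j)" using ij assms(1,2) by simp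
qed (use assms in auto)

text \<open>The matrices of \<open>f\<close> and \<open>g\<close> in the unit vectors are inverse to
  each other, because their products act as the identity on every vector.\<close>

lemma isometricI:
  fixes q r :: "'a::field qform"
  assumes n: "qdim q = n" "qdim r = n" and f: "linear_fun n n f" and g: "linear_fun n n g"
    and fg: "\<And>v. v \<in> carrier_vec n \<Longrightarrow> f (g v) = v" and gf: "\<And>v. v \<in> carrier_vec n \<Longrightarrow> g (f v) = v"
    and val: "\<And>v. v \<in> carrier_vec n \<Longrightarrow> qval r (f v) = qval q v"
  shows "q \<cong>\<^sub>q r"
proof -
  let ?M = "\<lambda>f. mat n n (\<lambda>(i, j). f (unit_vec n j) $ i)"
  have inv: "?M f * ?M g = 1\<^sub>m n"
    if f: "linear_fun n n f" and g: "linear_fun n n g" and fg: "\<And>v. v \<in> carrier_vec n \<Longrightarrow> f (g v) = v"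
    for f g :: "'a vec \<Rightarrow> 'a vec"
  proof (rule eq_mat_by_vec[where m=n and n=n])
    fix v :: "'a vec" assume v: "v \<in> carrier_vec n"
    then have gv: "g v \<in> carrier_vec n" using g unfolding linear_fun_def by auto
    have "(?M f * ?M g) *\<^sub>v v = ?M f *\<^sub>v (?M g *\<^sub>v v)"
      by (rule assoc_mult_mat_vec) (use v in auto)
    then show "(?M f * ?M g) *\<^sub>v v = 1\<^sub>m n *\<^sub>v v"
      using linear_fun_mat[OF g v] linear_fun_mat[OF f gv] fg v by simp
  qed auto
  have "invertible_mat (?M f)"
    unfolding invertible_mat_def inverts_mat_def
    using inv[OF f g fg] inv[OF g f gf] by (auto intro!: exI[of _ "?M g"])
  then show ?thesis unfolding isometric_def
    using n val linear_fun_mat[OF f] by (auto intro!: bexI[of _ "?M f"])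
qed

lemma isometricE:
  fixes q r :: "'a::field qform"
  assumes "q \<cong>\<^sub>q r"
  obtains f g where "qdim r = qdim q" "linear_fun (qdim q) (qdim q) f" "linear_fun (qdim q) (qdim q) g"
    "\<And>v. v \<in> carrier_vec (qdim q) \<Longrightarrow> f (g v) = v" "\<And>v. v \<in> carrier_vec (qdim q) \<Longrightarrow> g (f v) = v"
    "\<And>v. v \<in> carrier_vec (qdim q) \<Longrightarrow> qval r (f v) = qval q v"
proof -
  let ?n = "qdim q"
  from assms obtain T where T: "qdim r = ?n" "T \<in> carrier_mat ?n ?n" "invertible_mat T"
    "\<And>v. v \<in> carrier_vec ?n \<Longrightarrow> qval r (T *\<^sub>v v) = qval q v"
    unfolding isometric_def by auto
  from T(3) obtain S where S0: "T * S = 1\<^sub>m (dim_row T)" "S * T = 1\<^sub>m (dim_row S)"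
    unfolding invertible_mat_def inverts_mat_def by auto
  \<comment> \<open>\<open>invertible_mat\<close> says nothing about the size of the inverse; it is
    read off from the sizes of the two products.\<close>
  have S: "S \<in> carrier_mat ?n ?n"
    using S0 T(2) by (metis carrier_matD(1) carrier_matD(2) carrier_matI index_mult_mat(2,3) index_one_mat(3))
  have ST: "T * S = 1\<^sub>m ?n" "S * T = 1\<^sub>m ?n" using S0 S T(2) by auto
  have lin: "linear_fun ?n ?n (\<lambda>v. A *\<^sub>v v)" if "A \<in> carrier_mat ?n ?n" for A :: "'a mat"
    using that unfolding linear_fun_def by (auto simp: mult_add_distrib_mat_vec mult_mat_vec)
  show thesis
  proof (rule that[of "\<lambda>v. T *\<^sub>v v" "\<lambda>v. S *\<^sub>v v"])
    fix v :: "'a vec" assume v: "v \<in> carrier_vec ?n"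
    show "T *\<^sub>v (S *\<^sub>v v) = v" "S *\<^sub>v (T *\<^sub>v v) = v"
      using assoc_mult_mat_vec[OF T(2) S v] assoc_mult_mat_vec[OF S T(2) v] ST v by auto
  qed (use T S lin in auto)
qed

lemma isometric_refl [simp]: "q \<cong>\<^sub>q q"
  by (rule isometricI[of _ "qdim q" _ id id]) (auto simp: linear_fun_def)

lemma isometric_sym: "q \<cong>\<^sub>q r \<Longrightarrow> r \<cong>\<^sub>q q"
proof (erule isometricE)
  fix f g assume *: "qdim r = qdim q" "linear_fun (qdim q) (qdim q) f" "linear_fun (qdim q) (qdim q) g"
    "\<And>v. v \<in> carrier_vec (qdim q) \<Longrightarrow> f (g v) = v" "\<And>v. v \<in> carrier_vec (qdim q) \<Longrightarrow> g (f v) = v"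
    "\<And>v. v \<in> carrier_vec (qdim q) \<Longrightarrow> qval r (f v) = qval q v"
  show "r \<cong>\<^sub>q q"
  proof (rule isometricI[of _ "qdim q" _ g f])
    fix v :: "'a vec" assume v: "v \<in> carrier_vec (qdim q)"
    then show "qval q (g v) = qval r v" using * unfolding linear_fun_def by metis
  qed (use * in auto)
qed

lemma isometric_trans: "q \<cong>\<^sub>q r \<Longrightarrow> r \<cong>\<^sub>q s \<Longrightarrow> q \<cong>\<^sub>q s"
proof (erule isometricE, erule isometricE)
  fix f g f' g' assume *: "qdim r = qdim q" "linear_fun (qdim q) (qdim q) f" "linear_fun (qdim q) (qdim q) g"
    "\<And>v. v \<in> carrier_vec (qdim q) \<Longrightarrow> f (g v) = v" "\<And>v. v \<in> carrier_vec (qdim q) \<Longrightarrow> g (f v) = v"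
    "\<And>v. v \<in> carrier_vec (qdim q) \<Longrightarrow> qval r (f v) = qval q v"
   and **: "qdim s = qdim r" "linear_fun (qdim r) (qdim r) f'" "linear_fun (qdim r) (qdim r) g'"
    "\<And>v. v \<in> carrier_vec (qdim r) \<Longrightarrow> f' (g' v) = v" "\<And>v. v \<in> carrier_vec (qdim r) \<Longrightarrow> g' (f' v) = v"
    "\<And>v. v \<in> carrier_vec (qdim r) \<Longrightarrow> qval s (f' v) = qval r v"
  show "q \<cong>\<^sub>q s"
    by (rule isometricI[of _ "qdim q" _ "\<lambda>v. f' (f v)" "\<lambda>v. g (g' v)"])
      (use * ** in \<open>auto simp: linear_fun_def\<close>)
qed

lemma isometric_same_values:
  assumes "qdim q = qdim r" "\<And>v. v \<in> carrier_vec (qdim q) \<Longrightarrow> qval r v = qval q v"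
  shows "q \<cong>\<^sub>q r"
  by (rule isometricI[of _ "qdim q" _ id id]) (use assms in \<open>auto simp: linear_fun_def\<close>)

section \<open>Orthogonal sums in coordinates\<close>

lemma qdim_orth_sum [simp]: "qdim (q \<bottom>\<^sub>q r) = qdim q + qdim r"
  by (simp add: orth_sum_def)

lemma qval_orth_sum:
  "qval (q \<bottom>\<^sub>q r) v = qval q (vec_first v (qdim q)) + qval r (vec_last v (qdim r))"
  by (simp add: orth_sum_def)

lemma qdim_zero_form [simp]: "qdim zero_form = 0" by (simp add: zero_form_def)

lemma vec_first_append [simp]: "v \<in> carrier_vec n \<Longrightarrow> vec_first (v @\<^sub>v w) n = v"
  by (rule eq_vecI) (auto simp: vec_first_def)

lemma vec_last_append [simp]: "w \<in> carrier_vec n \<Longrightarrow> vec_last (v @\<^sub>v w) n = w"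
  by (rule eq_vecI) (auto simp: vec_last_def)

lemma qval_orth_sum_append:
  "v \<in> carrier_vec (qdim q) \<Longrightarrow> w \<in> carrier_vec (qdim r) \<Longrightarrow>
    qval (q \<bottom>\<^sub>q r) (v @\<^sub>v w) = qval q v + qval r w"
  by (simp add: qval_orth_sum)

lemma append_vec_cases:
  assumes "v \<in> carrier_vec (n + m)"
  obtains x y where "v = x @\<^sub>v y" "x \<in> carrier_vec n" "y \<in> carrier_vec m"
  using vec_first_last_append[OF assms] vec_first_carrier vec_last_carrier by metis

lemma append_vec_add:
  "x \<in> carrier_vec n \<Longrightarrow> x' \<in> carrier_vec n \<Longrightarrow> y \<in> carrier_vec m \<Longrightarrow> y' \<in> carrier_vec m \<Longrightarrow>
    (x @\<^sub>v y) + (x' @\<^sub>v y') = (x + x') @\<^sub>v (y + y')"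
  by (rule eq_vecI) auto

lemma append_vec_smult: "c \<cdot>\<^sub>v (x @\<^sub>v y) = (c \<cdot>\<^sub>v x) @\<^sub>v (c \<cdot>\<^sub>v y)"
  by (rule eq_vecI) auto

lemma linear_fun_append:
  assumes f: "linear_fun n n' f" and g: "linear_fun m m' g"
  shows "linear_fun (n + m) (n' + m') (\<lambda>v. f (vec_first v n) @\<^sub>v g (vec_last v m))"
  using assms unfolding linear_fun_def
  by (auto elim!: append_vec_cases
      simp: append_vec_add append_vec_add[of _ n' _ _ m'] append_vec_smult)

lemma linear_fun_swap: "linear_fun (n + m) (m + n) (\<lambda>v. vec_last v m @\<^sub>v vec_first v n)"
  unfolding linear_fun_def
  by (auto elim!: append_vec_cases simp: append_vec_add append_vec_smult intro!: append_carrier_vec)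

lemma orth_sum_cong:
  assumes "q \<cong>\<^sub>q q'" "r \<cong>\<^sub>q r'"
  shows "q \<bottom>\<^sub>q r \<cong>\<^sub>q q' \<bottom>\<^sub>q r'"
proof (rule isometricE[OF assms(1)], rule isometricE[OF assms(2)])
  fix f g f' g' assume *: "qdim q' = qdim q" "linear_fun (qdim q) (qdim q) f" "linear_fun (qdim q) (qdim q) g"
    "\<And>v. v \<in> carrier_vec (qdim q) \<Longrightarrow> f (g v) = v" "\<And>v. v \<in> carrier_vec (qdim q) \<Longrightarrow> g (f v) = v"
    "\<And>v. v \<in> carrier_vec (qdim q) \<Longrightarrow> qval q' (f v) = qval q v"
   and **: "qdim r' = qdim r" "linear_fun (qdim r) (qdim r) f'" "linear_fun (qdim r) (qdim r) g'"
    "\<And>v. v \<in> carrier_vec (qdim r) \<Longrightarrow> f' (g' v) = v" "\<And>v. v \<in> carrier_vec (qdim r) \<Longrightarrow> g' (f' v) = v"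
    "\<And>v. v \<in> carrier_vec (qdim r) \<Longrightarrow> qval r' (f' v) = qval r v"
  have c: "v \<in> carrier_vec (qdim q) \<Longrightarrow> f v \<in> carrier_vec (qdim q)"
    "v \<in> carrier_vec (qdim q) \<Longrightarrow> g v \<in> carrier_vec (qdim q)"
    "v \<in> carrier_vec (qdim r) \<Longrightarrow> f' v \<in> carrier_vec (qdim r)"
    "v \<in> carrier_vec (qdim r) \<Longrightarrow> g' v \<in> carrier_vec (qdim r)" for v
    using * ** unfolding linear_fun_def by auto
  show ?thesis
    by (rule isometricI[of _ "qdim q + qdim r" _
          "\<lambda>v. f (vec_first v (qdim q)) @\<^sub>v f' (vec_last v (qdim r))"
          "\<lambda>v. g (vec_first v (qdim q)) @\<^sub>v g' (vec_last v (qdim r))"])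
      (use * ** c in \<open>auto elim!: append_vec_cases simp: linear_fun_append qval_orth_sum\<close>)
qed

lemma orth_sum_comm: "q \<bottom>\<^sub>q r \<cong>\<^sub>q r \<bottom>\<^sub>q q"
  by (rule isometricI[of _ "qdim q + qdim r" _
        "\<lambda>v. vec_last v (qdim r) @\<^sub>v vec_first v (qdim q)" "\<lambda>v. vec_last v (qdim q) @\<^sub>v vec_first v (qdim r)"])
    (use linear_fun_swap[of "qdim q" "qdim r"] linear_fun_swap[of "qdim r" "qdim q"] in
      \<open>auto elim!: append_vec_cases simp: qval_orth_sum add.commute\<close>)

lemma orth_sum_assoc:
  fixes q r s :: "'a::field qform"
  shows "(q \<bottom>\<^sub>q r) \<bottom>\<^sub>q s \<cong>\<^sub>q q \<bottom>\<^sub>q (r \<bottom>\<^sub>q s)"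
proof (rule isometric_same_values)
  fix v :: "'a vec" assume "v \<in> carrier_vec (qdim ((q \<bottom>\<^sub>q r) \<bottom>\<^sub>q s))"
  then have v: "dim_vec v = qdim q + qdim r + qdim s" by auto
  have "vec_first v (qdim q) = vec_first (vec_first v (qdim q + qdim r)) (qdim q)"
    "vec_first (vec_last v (qdim r + qdim s)) (qdim r) = vec_last (vec_first v (qdim q + qdim r)) (qdim r)"
    "vec_last (vec_last v (qdim r + qdim s)) (qdim s) = vec_last v (qdim s)"
    by (rule eq_vecI; use v in \<open>auto simp: vec_first_def vec_last_def add.assoc\<close>)+
  then show "qval (q \<bottom>\<^sub>q r \<bottom>\<^sub>q s) v = qval ((q \<bottom>\<^sub>q r) \<bottom>\<^sub>q s) v"
    by (simp add: qval_orth_sum)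
qed simp

lemma orth_sum_zero_right:
  fixes q :: "'a::field qform"
  shows "q \<bottom>\<^sub>q zero_form \<cong>\<^sub>q q"
proof (rule isometric_same_values)
  fix v :: "'a vec" assume v: "v \<in> carrier_vec (qdim (q \<bottom>\<^sub>q zero_form))"
  then have "vec_first v (qdim q) = v" by (auto simp: vec_first_def)
  then show "qval q v = qval (q \<bottom>\<^sub>q zero_form) v" by (simp add: qval_orth_sum zero_form_def)
qed simp

lemma orth_sum_zero_left: "zero_form \<bottom>\<^sub>q q \<cong>\<^sub>q q"
  using isometric_trans[OF orth_sum_comm orth_sum_zero_right] .

lemma orth_sum_swap: "(a \<bottom>\<^sub>q b) \<bottom>\<^sub>q (c \<bottom>\<^sub>q d) \<cong>\<^sub>q (a \<bottom>\<^sub>q c) \<bottom>\<^sub>q (b \<bottom>\<^sub>q d)"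
proof -
  have "b \<bottom>\<^sub>q (c \<bottom>\<^sub>q d) \<cong>\<^sub>q c \<bottom>\<^sub>q (b \<bottom>\<^sub>q d)"
    using isometric_trans[OF isometric_sym[OF orth_sum_assoc]
        isometric_trans[OF orth_sum_cong[OF orth_sum_comm isometric_refl] orth_sum_assoc]] .
  then show ?thesis
    using isometric_trans[OF orth_sum_assoc
        isometric_trans[OF orth_sum_cong[OF isometric_refl] isometric_sym[OF orth_sum_assoc]]] by blast
qed

lemma scale_orth_sum: "scale_form d (q \<bottom>\<^sub>q r) = scale_form d q \<bottom>\<^sub>q scale_form d r"
  by (simp add: scale_form_def orth_sum_def distrib_left)

lemma scale_isometric: "q \<cong>\<^sub>q r \<Longrightarrow> scale_form d q \<cong>\<^sub>q scale_form d r"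
  unfolding scale_form_def isometric_def qform.sel by metis

lemma hyperbolic_add: "hyperbolic (i + j) \<cong>\<^sub>q hyperbolic i \<bottom>\<^sub>q hyperbolic j"
proof (induction i)
  case 0
  then show ?case using isometric_sym[OF orth_sum_zero_left] by simp
next
  case (Suc i)
  then show ?case
    using isometric_trans[OF orth_sum_cong[OF isometric_refl] isometric_sym[OF orth_sum_assoc]] by fastforce
qed

section \<open>Witt equivalence\<close>

lemma witt_equiv_refl [simp]: "witt_equiv q q"
  unfolding witt_equiv_def using isometric_refl by blast

lemma witt_equiv_sym: "witt_equiv q r \<Longrightarrow> witt_equiv r q"
  unfolding witt_equiv_def using isometric_sym by blast

text \<open>With \<open>k\<close> further planes on the first isometry and \<open>j\<close> on the
  second, both pass through \<open>r\<close> plus \<open>j + k\<close> planes.\<close>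

lemma witt_equiv_trans:
  fixes q r s :: "'a::field qform"
  assumes "witt_equiv q r" "witt_equiv r s" shows "witt_equiv q s"
proof -
  obtain i j k l where 1: "q \<bottom>\<^sub>q hyperbolic i \<cong>\<^sub>q r \<bottom>\<^sub>q hyperbolic j"
    and 2: "r \<bottom>\<^sub>q hyperbolic k \<cong>\<^sub>q s \<bottom>\<^sub>q hyperbolic l"
    using assms unfolding witt_equiv_def by blast
  have add: "p \<bottom>\<^sub>q hyperbolic (m + n) \<cong>\<^sub>q (p \<bottom>\<^sub>q hyperbolic m) \<bottom>\<^sub>q hyperbolic n" for p :: "'a qform" and m n
    using isometric_trans[OF orth_sum_cong[OF isometric_refl hyperbolic_add] isometric_sym[OF orth_sum_assoc]] .
  have "q \<bottom>\<^sub>q hyperbolic (i + k) \<cong>\<^sub>q (r \<bottom>\<^sub>q hyperbolic j) \<bottom>\<^sub>q hyperbolic k"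
    using isometric_trans[OF add orth_sum_cong[OF 1 isometric_refl]] .
  moreover have "(r \<bottom>\<^sub>q hyperbolic j) \<bottom>\<^sub>q hyperbolic k \<cong>\<^sub>q (r \<bottom>\<^sub>q hyperbolic k) \<bottom>\<^sub>q hyperbolic j"
    using isometric_trans[OF isometric_sym[OF add] add] by (metis add.commute isometric_sym isometric_trans add)
  moreover have "(r \<bottom>\<^sub>q hyperbolic k) \<bottom>\<^sub>q hyperbolic j \<cong>\<^sub>q s \<bottom>\<^sub>q hyperbolic (l + j)"
    using isometric_trans[OF orth_sum_cong[OF 2 isometric_refl] isometric_sym[OF add]] .
  ultimately show ?thesis unfolding witt_equiv_def using isometric_trans by blast
qed

lemma isometric_witt_equiv: "q \<cong>\<^sub>q r \<Longrightarrow> witt_equiv q r"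
  unfolding witt_equiv_def using orth_sum_cong[OF _ isometric_refl] by blast

lemma witt_equiv_orth_sum:
  fixes q q' r r' :: "'a::field qform"
  assumes "witt_equiv q q'" "witt_equiv r r'" shows "witt_equiv (q \<bottom>\<^sub>q r) (q' \<bottom>\<^sub>q r')"
proof -
  obtain i j k l where 1: "q \<bottom>\<^sub>q hyperbolic i \<cong>\<^sub>q q' \<bottom>\<^sub>q hyperbolic j"
    and 2: "r \<bottom>\<^sub>q hyperbolic k \<cong>\<^sub>q r' \<bottom>\<^sub>q hyperbolic l"
    using assms unfolding witt_equiv_def by blast
  have h: "(p \<bottom>\<^sub>q s) \<bottom>\<^sub>q hyperbolic (m + n) \<cong>\<^sub>q (p \<bottom>\<^sub>q hyperbolic m) \<bottom>\<^sub>q (s \<bottom>\<^sub>q hyperbolic n)"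
    for p s :: "'a qform" and m n
    using isometric_trans[OF orth_sum_cong[OF isometric_refl hyperbolic_add] orth_sum_swap] .
  show ?thesis unfolding witt_equiv_def
    using isometric_trans[OF h isometric_trans[OF orth_sum_cong[OF 1 2] isometric_sym[OF h]]] by blast
qed

lemma hyperbolic_witt_zero: "witt_equiv (hyperbolic i) zero_form"
proof -
  have "hyperbolic i \<bottom>\<^sub>q hyperbolic 0 \<cong>\<^sub>q zero_form \<bottom>\<^sub>q hyperbolic i"
    using isometric_trans[OF orth_sum_zero_right isometric_sym[OF orth_sum_zero_left]] by simp
  then show ?thesis unfolding witt_equiv_def by blast
qed

quotient_type (overloaded) 'a witt = "'a::field qform" / witt_equiv
  by (rule equivpI) (auto intro: reflpI sympI transpI witt_equiv_sym witt_equiv_trans)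

instantiation witt :: (field) comm_monoid_add
begin

lift_definition zero_witt :: "'a witt" is zero_form .

lift_definition plus_witt :: "'a witt \<Rightarrow> 'a witt \<Rightarrow> 'a witt" is orth_sum
  by (rule witt_equiv_orth_sum)

instance
  by standard (transfer, auto intro: isometric_witt_equiv orth_sum_assoc orth_sum_comm orth_sum_zero_left)+

end

section \<open>Isotropic vectors of hyperbolic forms\<close>

text \<open>A totally isotropic subspace of dimension at least \<open>k\<close>, with the dimension bound expressed by
  linear forms: fewer than \<open>k\<close> of them always have a common nonzero zero.\<close>

definition tot_isotropic :: "nat \<Rightarrow> 'a::field qform \<Rightarrow> bool" where
  "tot_isotropic k q \<longleftrightarrow> (\<exists>U \<subseteq> carrier_vec (qdim q).
     (\<forall>u \<in> U. qval q u = 0) \<and> (\<forall>u \<in> U. \<forall>v \<in> U. polar q u v = 0) \<and>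
     (\<forall>fs. length fs < k \<and> (\<forall>f \<in> set fs. linear_form (qdim q) f) \<longrightarrow>
        (\<exists>u \<in> U. u \<noteq> 0\<^sub>v (qdim q) \<and> (\<forall>f \<in> set fs. f u = 0))))"

text \<open>The subspace is moved by the isometry, and linear forms are pulled back along
  it.\<close>

lemma tot_isotropic_isometric:
  fixes q r :: "'a::field qform"
  assumes qr: "q \<cong>\<^sub>q r" and k: "tot_isotropic k q"
  shows "tot_isotropic k r"
proof (rule isometricE[OF qr])
  fix f g :: "'a vec \<Rightarrow> 'a vec"
  assume *: "qdim r = qdim q" "linear_fun (qdim q) (qdim q) f" "linear_fun (qdim q) (qdim q) g"
    "\<And>v. v \<in> carrier_vec (qdim q) \<Longrightarrow> f (g v) = v" "\<And>v. v \<in> carrier_vec (qdim q) \<Longrightarrow> g (f v) = v"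
    "\<And>v. v \<in> carrier_vec (qdim q) \<Longrightarrow> qval r (f v) = qval q v"
  from k obtain U where U: "U \<subseteq> carrier_vec (qdim q)" "\<And>u. u \<in> U \<Longrightarrow> qval q u = 0"
    "\<And>u v. u \<in> U \<Longrightarrow> v \<in> U \<Longrightarrow> polar q u v = 0"
    "\<And>fs. length fs < k \<Longrightarrow> \<forall>f \<in> set fs. linear_form (qdim q) f \<Longrightarrow>
        \<exists>u \<in> U. u \<noteq> 0\<^sub>v (qdim q) \<and> (\<forall>f \<in> set fs. f u = 0)"
    unfolding tot_isotropic_def by auto
  have fadd: "f (u + v) = f u + f v" and fc: "f u \<in> carrier_vec (qdim q)" 
    if "u \<in> carrier_vec (qdim q)" "v \<in> carrier_vec (qdim q)" for u v
    using that *(2) unfolding linear_fun_def by auto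
  have f0: "f (0\<^sub>v (qdim q)) = 0\<^sub>v (qdim q)"
  proof -
    let ?z = "0\<^sub>v (qdim q)"
    have "f (0 \<cdot>\<^sub>v ?z) = 0 \<cdot>\<^sub>v f ?z" using *(2) unfolding linear_fun_def by (metis zero_carrier_vec)
    moreover have "0 \<cdot>\<^sub>v ?z = (?z :: 'a vec)" by (rule eq_vecI) auto
    moreover have "0 \<cdot>\<^sub>v f ?z = ?z" using fc[of ?z ?z] by (intro eq_vecI) auto
    ultimately show ?thesis by simp
  qed
  show ?thesis unfolding tot_isotropic_def
  proof (intro exI[of _ "f ` U"] conjI ballI allI impI)
    show "f ` U \<subseteq> carrier_vec (qdim r)" using U(1) fc *(1) by auto
  next
    fix u assume "u \<in> f ` U" then show "qval r u = 0" using U(1,2) *(6) by auto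
  next
    fix u v assume "u \<in> f ` U" "v \<in> f ` U"
    then obtain x y where xy: "x \<in> U" "y \<in> U" "u = f x" "v = f y" by blast
    then have c: "x \<in> carrier_vec (qdim q)" "y \<in> carrier_vec (qdim q)" using U(1) by auto
    then have "x + y \<in> carrier_vec (qdim q)" by simp
    then have "polar r u v = polar q x y"
      unfolding polar_def xy using c fadd *(6) by metis
    then show "polar r u v = 0" using U(3) xy by simp
  next
    fix fs :: "('a vec \<Rightarrow> 'a) list"
    assume fs: "length fs < k \<and> (\<forall>f \<in> set fs. linear_form (qdim r) f)"
    have "\<exists>u \<in> U. u \<noteq> 0\<^sub>v (qdim q) \<and> (\<forall>h \<in> set (map (\<lambda>h u. h (f u)) fs). h u = 0)"
    proof (rule U(4))
      show "\<forall>h \<in> set (map (\<lambda>h u. h (f u)) fs). linear_form (qdim q) h"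
        using fs *(1,2) unfolding linear_form_def linear_fun_def by auto
    qed (use fs in auto)
    then obtain u where u: "u \<in> U" "u \<noteq> 0\<^sub>v (qdim q)" "\<forall>h \<in> set fs. h (f u) = 0" by auto
    have "f u \<noteq> 0\<^sub>v (qdim q)"
    proof
      assume "f u = 0\<^sub>v (qdim q)"
      then have "g (f u) = g (f (0\<^sub>v (qdim q)))" using f0 by simp
      then show False using u(1,2) U(1) *(5) by auto
    qed
    then show "\<exists>u \<in> f ` U. u \<noteq> 0\<^sub>v (qdim r) \<and> (\<forall>h \<in> set fs. h u = 0)" using u *(1) by auto
  qed
qed

lemma qdim_hyperbolic [simp]: "qdim (hyperbolic k) = 2 * k"
  by (induction k) (auto simp: hyperbolic_plane_def)

lemma qval_hyperbolic:
  "v \<in> carrier_vec (2 * k) \<Longrightarrow> qval (hyperbolic k) v = (\<Sum>i<k. v $ (2 * i) * v $ Suc (2 * i))"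
proof (induction k arbitrary: v)
  case 0
  then show ?case by (simp add: zero_form_def)
next
  case (Suc k)
  have "qval (hyperbolic (Suc k)) v =
      qval hyperbolic_plane (vec_first v 2) + qval (hyperbolic k) (vec_last v (2 * k))"
    by (simp add: qval_orth_sum) (simp add: hyperbolic_plane_def)
  also have "\<dots> = v $ 0 * v $ 1 + (\<Sum>i<k. v $ (2 * Suc i) * v $ Suc (2 * Suc i))"
  proof -
    have "vec_last v (2 * k) $ (2 * i) = v $ (2 * Suc i)"
         "vec_last v (2 * k) $ Suc (2 * i) = v $ Suc (2 * Suc i)" if "i < k" for i
      using that Suc.prems by (auto simp: vec_last_def)
    then show ?thesis
      by (subst Suc.IH) (auto simp: hyperbolic_plane_def vec_first_def)
  qed
  also have "\<dots> = (\<Sum>i<Suc k. v $ (2 * i) * v $ Suc (2 * i))"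
    by (subst sum.lessThan_Suc_shift) simp
  finally show ?case .
qed

text \<open>The vectors whose coordinates of odd index vanish form a totally isotropic space of
  dimension \<open>k\<close>, on which fewer than \<open>k\<close> linear equations have a
  nontrivial solution.\<close>

lemma tot_isotropic_hyperbolic: "tot_isotropic k (hyperbolic k :: 'a::field qform)"
  unfolding tot_isotropic_def
proof (intro exI[of _ "{v \<in> carrier_vec (2 * k). \<forall>i<k. v $ Suc (2 * i) = 0}"] conjI ballI allI impI)
  let ?U = "{v \<in> carrier_vec (2 * k). \<forall>i<k. v $ Suc (2 * i) = (0::'a)}"
  have val: "qval (hyperbolic k) v = 0" if "v \<in> ?U" for v
    using that by (auto simp: qval_hyperbolic)
  show "?U \<subseteq> carrier_vec (qdim (hyperbolic k :: 'a qform))" by auto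
  show "qval (hyperbolic k) v = 0" if "v \<in> ?U" for v using val[OF that] .
  show "polar (hyperbolic k) u v = 0" if "u \<in> ?U" "v \<in> ?U" for u v
  proof -
    have "u + v \<in> ?U" using that by auto
    then show ?thesis using val that by (simp add: polar_def)
  qed
  fix fs :: "('a vec \<Rightarrow> 'a) list"
  assume fs: "length fs < k \<and> (\<forall>f \<in> set fs. linear_form (qdim (hyperbolic k :: 'a qform)) f)"
  define e :: "nat \<Rightarrow> 'a vec" where "e j = unit_vec (2 * k) (2 * j)" for j
  \<comment> \<open>Row \<open>i\<close> lists the values of the \<open>i\<close>-th form on the
    basis \<open>e\<close> and is zero beyond the list. As there are at most \<open>k - 1\<close>
    forms, overwriting row \<open>k - 1\<close> by zero loses nothing and makes the determinant
    vanish visibly.\<close>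
  define c where "c i = vec k (\<lambda>j. if i < length fs then (fs ! i) (e j) else 0)" for i
  define A where "A = mat\<^sub>r k k (\<lambda>i. if i = k - 1 then 0\<^sub>v k else c i)"
  have "k - 1 < k" using fs by auto
  then have "det A = 0" unfolding A_def by (rule det_row_0) (auto simp: c_def)
  moreover have A: "A \<in> carrier_mat k k" by (simp add: A_def)
  ultimately obtain x where x: "x \<in> carrier_vec k" "x \<noteq> 0\<^sub>v k" "A *\<^sub>v x = 0\<^sub>v k"
    using det_0_iff_vec_prod_zero_field[OF A] by auto
  define u where "u = vec (2 * k) (\<lambda>i. if even i then x $ (i div 2) else 0)"
  have u: "u \<in> ?U" unfolding u_def by auto
  have "f u = 0" if f: "f \<in> set fs" for f
  proof -
    from f obtain i where i: "i < length fs" "f = fs ! i" by (auto simp: in_set_conv_nth)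
    have "f u = (\<Sum>j<2*k. u $ j * f (unit_vec (2 * k) j))"
      by (rule linear_form_unit) (use fs f u in auto)
    also have "\<dots> = (\<Sum>j\<in>(\<lambda>j. 2 * j) ` {..<k}. u $ j * f (unit_vec (2 * k) j))"
    proof (rule sum.mono_neutral_right)
      show "\<forall>i\<in>{..<2 * k} - (*) 2 ` {..<k}. u $ i * f (unit_vec (2 * k) i) = 0"
      proof
        fix i assume i: "i \<in> {..<2 * k} - (*) 2 ` {..<k}"
        have "odd i"
        proof
          assume "even i"
          then obtain j where "i = 2 * j" by blast
          then show False using i by auto
        qed
        then show "u $ i * f (unit_vec (2 * k) i) = 0" using i by (simp add: u_def)
      qed
    qed auto
    also have "\<dots> = (\<Sum>j<k. c i $ j * x $ j)"
      by (subst sum.reindex) (auto simp: inj_on_def u_def c_def i e_def intro!: sum.cong)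
    also have "\<dots> = (A *\<^sub>v x) $ i"
      using i fs x(1) A by (auto simp: A_def scalar_prod_def atLeast0LessThan c_def)
    also have "\<dots> = 0" using x(3) i fs by simp
    finally show ?thesis .
  qed
  moreover have "u \<noteq> 0\<^sub>v (2 * k)"
  proof
    assume 0: "u = 0\<^sub>v (2 * k)"
    have "x $ i = 0" if "i < k" for i
    proof -
      have "u $ (2 * i) = x $ i" using that by (simp add: u_def)
      then show ?thesis using 0 that by simp
    qed
    then show False using x(1,2) by (metis carrier_vecD eq_vecI index_zero_vec(1,2))
  qed
  ultimately show "\<exists>u\<in>?U. u \<noteq> 0\<^sub>v (qdim (hyperbolic k :: 'a qform)) \<and> (\<forall>f\<in>set fs. f u = 0)"
    using u by (intro bexI[of _ u]) auto
qed

text \<open>If the isotropic line spanned by \<open>(0, x, 0)\<close> lies in the subspace, then total isotropy makes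
  the last coordinate vanish on it, so one linear form is always saved.\<close>

lemma tot_isotropic_hyperbolic_plane:
  fixes q :: "'a::field qform"
  assumes "tot_isotropic (Suc k) (q \<bottom>\<^sub>q hyperbolic_plane)"
  shows "tot_isotropic k q"
proof -
  let ?n = "qdim q" and ?H = "hyperbolic_plane :: 'a qform"
  define h :: "'a \<Rightarrow> 'a \<Rightarrow> 'a vec" where "h x y = vec 2 (\<lambda>i. if i = 0 then x else y)" for x y
  have h: "h x y \<in> carrier_vec 2" "h x y + h x' y' = h (x + x') (y + y')" "qval ?H (h x y) = x * y" for x y x' y'
    by (auto simp: h_def hyperbolic_plane_def)
  have dH: "qdim ?H = 2" by (simp add: hyperbolic_plane_def)
  have decomp: "\<exists>w \<in> carrier_vec ?n. \<exists>x y. u = w @\<^sub>v h x y" if u: "u \<in> carrier_vec (?n + 2)" for u :: "'a vec"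
  proof (rule append_vec_cases[OF u])
    fix w z :: "'a vec" assume *: "u = w @\<^sub>v z" "w \<in> carrier_vec ?n" "z \<in> carrier_vec 2"
    have "z = h (z $ 0) (z $ 1)" using *(3) by (intro eq_vecI) (auto simp: h_def less_2_cases_iff)
    then show ?thesis using * by metis
  qed
  from assms obtain U where U: "U \<subseteq> carrier_vec (?n + 2)" "\<And>u. u \<in> U \<Longrightarrow> qval (q \<bottom>\<^sub>q ?H) u = 0"
    "\<And>u v. u \<in> U \<Longrightarrow> v \<in> U \<Longrightarrow> polar (q \<bottom>\<^sub>q ?H) u v = 0"
    "\<And>fs. length fs < Suc k \<Longrightarrow> \<forall>f \<in> set fs. linear_form (?n + 2) f \<Longrightarrow>
        \<exists>u \<in> U. u \<noteq> 0\<^sub>v (?n + 2) \<and> (\<forall>f \<in> set fs. f u = 0)"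
    unfolding tot_isotropic_def qdim_orth_sum dH by auto
  have val: "qval (q \<bottom>\<^sub>q ?H) (w @\<^sub>v h x y) = qval q w + x * y" if "w \<in> carrier_vec ?n" for w x y
    using that h by (simp add: qval_orth_sum_append dH)
  have pol: "polar (q \<bottom>\<^sub>q ?H) (w @\<^sub>v h x y) (w' @\<^sub>v h x' y') = polar q w w' + (x * y' + x' * y)"
    if "w \<in> carrier_vec ?n" "w' \<in> carrier_vec ?n" for w x y w' x' y'
    using that by (simp add: polar_def append_vec_add[OF that h(1) h(1)] h(2) val algebra_simps)
  \<comment> \<open>The candidate consists of the projections to \<open>q\<close> of those vectors
    of \<open>U\<close> whose last coordinate is zero; on these the hyperbolic plane contributes
    nothing.\<close>
  define U' where "U' = {w \<in> carrier_vec ?n. \<exists>x. w @\<^sub>v h x 0 \<in> U}"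
  have lin1: "linear_form (?n + 2) (\<lambda>u. f (vec_first u ?n))" if "linear_form ?n f" for f :: "'a vec \<Rightarrow> 'a"
  proof -
    have 1: "vec_first (v + w) ?n = vec_first v ?n + vec_first w ?n"
      if "v \<in> carrier_vec (?n + 2)" "w \<in> carrier_vec (?n + 2)" for v w :: "'a vec"
      using that by (intro eq_vecI) (auto simp: vec_first_def)
    have 2: "vec_first (c \<cdot>\<^sub>v v) ?n = c \<cdot>\<^sub>v vec_first v ?n"
      if "v \<in> carrier_vec (?n + 2)" for v :: "'a vec" and c
      using that by (intro eq_vecI) (auto simp: vec_first_def)
    show ?thesis using that 1 2 vec_first_carrier unfolding linear_form_def by metis
  qed
  have lin2: "linear_form (?n + 2) (\<lambda>u. u $ ?n)" "linear_form (?n + 2) (\<lambda>u. u $ (?n + 1))"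
    by (auto simp: linear_form_def)
  have ent: "(w @\<^sub>v h x y) $ ?n = x" "(w @\<^sub>v h x y) $ (?n + 1) = y" if "w \<in> carrier_vec ?n" for w x y
    using that by (auto simp: h_def)
  have app0: "0\<^sub>v ?n @\<^sub>v h 0 0 = 0\<^sub>v (?n + 2)" by (rule eq_vecI) (auto simp: h_def)
  show ?thesis unfolding tot_isotropic_def
  proof (intro exI[of _ U'] conjI ballI allI impI)
    show "U' \<subseteq> carrier_vec ?n" unfolding U'_def by auto
  next
    fix u assume "u \<in> U'" then show "qval q u = 0" unfolding U'_def using U(2) val by force
  next
    fix u v assume "u \<in> U'" "v \<in> U'" then show "polar q u v = 0" unfolding U'_def using U(3) pol by force
  next
    fix fs :: "('a vec \<Rightarrow> 'a) list" assume fs: "length fs < k \<and> (\<forall>f \<in> set fs. linear_form ?n f)"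
    let ?fs = "map (\<lambda>f u. f (vec_first u ?n)) fs"
    have *: "\<exists>u \<in> U. u \<noteq> 0\<^sub>v (?n + 2) \<and> (\<forall>f \<in> set (l # ?fs). f u = 0)" if "linear_form (?n + 2) l" for l
      by (rule U(4)) (use that fs lin1 in auto)
    from *[OF lin2(2)] obtain u where u: "u \<in> U" "u \<noteq> 0\<^sub>v (?n + 2)" "u $ (?n + 1) = 0"
      "\<forall>f \<in> set fs. f (vec_first u ?n) = 0" by auto
    from u(1) U(1) decomp obtain w x y where w: "w \<in> carrier_vec ?n" "u = w @\<^sub>v h x y" by blast
    then have y: "y = 0" using u(3) ent by simp
    show "\<exists>u \<in> U'. u \<noteq> 0\<^sub>v ?n \<and> (\<forall>f \<in> set fs. f u = 0)"
    proof (cases "w = 0\<^sub>v ?n")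
      case False
      then show ?thesis using u w y unfolding U'_def by (intro bexI[of _ w]) auto
    next
      case True
      then have x: "x \<noteq> 0" using u(2) w(2) y app0 by auto
      \<comment> \<open>Here \<open>u\<close> lies in the hyperbolic plane. The extra form is now
        spent on the other coordinate, which gives \<open>x' = 0\<close>; orthogonality to
        \<open>u\<close> then gives \<open>y' = 0\<close>, so the nonzero vector \<open>u'\<close>
        has nonzero projection \<open>w'\<close>.\<close>
      from *[OF lin2(1)] obtain u' where u': "u' \<in> U" "u' \<noteq> 0\<^sub>v (?n + 2)" "u' $ ?n = 0"
        "\<forall>f \<in> set fs. f (vec_first u' ?n) = 0" by auto
      from u'(1) U(1) decomp obtain w' x' y' where w': "w' \<in> carrier_vec ?n" "u' = w' @\<^sub>v h x' y'" by blast
      then have x': "x' = 0" using u'(3) ent by simp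
      have "qval q (0\<^sub>v ?n) = 0" using U(2)[OF u(1)] val[OF w(1)] w(2) y True by simp
      then have "polar q w' w = 0" using True w'(1) by (simp add: polar_def)
      then have "x * y' = 0" using U(3)[OF u'(1) u(1)] pol[OF w'(1) w(1)] w(2) w'(2) y by simp
      then have "y' = 0" using x by simp
      then show ?thesis using u' w' x' app0 unfolding U'_def by (intro bexI[of _ w']) auto
    qed
  qed
qed

lemma tot_isotropic_orth_sum_hyperbolic: "tot_isotropic (k + i) (q \<bottom>\<^sub>q hyperbolic i) \<Longrightarrow> tot_isotropic k q"
proof (induction i arbitrary: q k)
  case 0
  then show ?case using tot_isotropic_isometric[OF orth_sum_zero_right] by simp
next
  case (Suc i)
  have "tot_isotropic (Suc k + i) ((q \<bottom>\<^sub>q hyperbolic_plane) \<bottom>\<^sub>q hyperbolic i)"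
    using tot_isotropic_isometric[OF isometric_sym[OF orth_sum_assoc]] Suc.prems by auto
  then show ?case using Suc.IH tot_isotropic_hyperbolic_plane by blast
qed

text \<open>After adding \<open>i\<close> planes, \<open>q\<close> becomes the hyperbolic form with
  \<open>n + i\<close> planes, which has a totally isotropic subspace of dimension
  \<open>n + i\<close>. Each plane that is removed again costs at most one dimension.\<close>

lemma witt_zero_tot_isotropic:
  assumes "witt_equiv q zero_form" "qdim q = 2 * n"
  shows "tot_isotropic n q"
proof -
  obtain i j where ij: "q \<bottom>\<^sub>q hyperbolic i \<cong>\<^sub>q zero_form \<bottom>\<^sub>q hyperbolic j"
    using assms(1) unfolding witt_equiv_def by blast
  then have "qdim (q \<bottom>\<^sub>q hyperbolic i) = qdim (zero_form \<bottom>\<^sub>q hyperbolic j :: 'a qform)"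
    unfolding isometric_def by blast
  then have j: "j = n + i" using assms(2) by simp
  have "hyperbolic j \<cong>\<^sub>q q \<bottom>\<^sub>q hyperbolic i"
    using isometric_trans[OF isometric_sym[OF orth_sum_zero_left] isometric_sym[OF ij]] .
  then show ?thesis using tot_isotropic_isometric[OF _ tot_isotropic_hyperbolic] tot_isotropic_orth_sum_hyperbolic j by blast
qed

section \<open>The classes of binary forms\<close>

text \<open>The plane usually written [a, b]. The forms in the argument are orthogonal sums of such
  planes, and \<open>binary_sum\<close> takes them as lists of coefficient pairs.\<close>

definition binary_form :: "'a::field \<Rightarrow> 'a \<Rightarrow> 'a qform" where
  "binary_form a b = QForm 2 (\<lambda>v. a * (v $ 0)\<^sup>2 + v $ 0 * v $ 1 + b * (v $ 1)\<^sup>2)"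

definition binary_sum :: "('a::field \<times> 'a) list \<Rightarrow> 'a qform" where
  "binary_sum ps = foldr (\<lambda>(a, b) r. binary_form a b \<bottom>\<^sub>q r) ps zero_form"

definition binary_class :: "'a::field \<Rightarrow> 'a \<Rightarrow> 'a witt" where
  "binary_class a b = abs_witt (binary_form a b)"

lemma qdim_binary_form [simp]: "qdim (binary_form a b) = 2"
  by (simp add: binary_form_def)

lemma qdim_binary_sum: "qdim (binary_sum ps) = 2 * length ps"
  by (induction ps) (auto simp: binary_sum_def)

lemma qval_binary_sum:
  "v \<in> carrier_vec (2 * length ps) \<Longrightarrow> qval (binary_sum ps) v =
    (\<Sum>i<length ps. fst (ps ! i) * (v $ (2 * i))\<^sup>2 + v $ (2 * i) * v $ Suc (2 * i) +
       snd (ps ! i) * (v $ Suc (2 * i))\<^sup>2)"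
proof (induction ps arbitrary: v)
  case Nil
  then show ?case by (simp add: binary_sum_def zero_form_def)
next
  case (Cons p ps)
  obtain a b where p: "p = (a, b)" by fastforce
  have last: "vec_last v (2 * length ps) $ (2 * i) = v $ (2 * Suc i)"
       "vec_last v (2 * length ps) $ Suc (2 * i) = v $ Suc (2 * Suc i)" if "i < length ps" for i
    using that Cons.prems by (auto simp: vec_last_def)
  have "qval (binary_sum (p # ps)) v =
      qval (binary_form a b) (vec_first v 2) + qval (binary_sum ps) (vec_last v (2 * length ps))"
    using qdim_binary_sum[of ps] by (simp add: binary_sum_def qval_orth_sum p)
  then show ?case
    by (subst (asm) Cons.IH)
      (auto simp: binary_form_def vec_first_def p last sum.lessThan_Suc_shift simp del: sum.lessThan_Suc)
qed

lemma abs_witt_orth_sum: "abs_witt (q \<bottom>\<^sub>q r) = abs_witt q + abs_witt r"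
  by (simp add: plus_witt.abs_eq)

lemma abs_witt_zero: "abs_witt zero_form = 0"
  by (simp add: zero_witt_def)

lemma abs_witt_binary_sum: "abs_witt (binary_sum ps) = (\<Sum>(a, b)\<leftarrow>ps. binary_class a b)"
  by (induction ps) (auto simp: binary_sum_def abs_witt_orth_sum abs_witt_zero binary_class_def)

text \<open>A trivial sum of n planes has a totally isotropic subspace of dimension n, so up to n -
  1 coordinates, listed in \<open>ks\<close>, may be required to vanish on a nonzero isotropic
  vector. Killing the second coordinate of [a, b] leaves only a x^2; killing both drops the plane.
  All later statements about slots are read off from such vectors.\<close>

lemma witt_zero_isotropic:
  fixes ps :: "('a::field \<times> 'a) list"
  assumes 0: "(\<Sum>(a, b)\<leftarrow>ps. binary_class a b) = 0"
    and I: "length ks < length ps" "\<forall>k \<in> set ks. k < 2 * length ps"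
  obtains v where "\<exists>k < 2 * length ps. v k \<noteq> 0" "\<And>k. k \<in> set ks \<Longrightarrow> v k = 0"
    "(\<Sum>i<length ps. fst (ps ! i) * (v (2 * i))\<^sup>2 + v (2 * i) * v (Suc (2 * i)) +
       snd (ps ! i) * (v (Suc (2 * i)))\<^sup>2) = 0"
proof -
  have "witt_equiv (binary_sum ps) zero_form"
    using 0 unfolding abs_witt_binary_sum[symmetric] abs_witt_zero[symmetric] witt.abs_eq_iff .
  from witt_zero_tot_isotropic[OF this qdim_binary_sum] obtain U
    where U: "U \<subseteq> carrier_vec (2 * length ps)" "\<And>u. u \<in> U \<Longrightarrow> qval (binary_sum ps) u = 0"
    "\<And>fs. length fs < length ps \<Longrightarrow> \<forall>f \<in> set fs. linear_form (2 * length ps) f \<Longrightarrow>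
        \<exists>u \<in> U. u \<noteq> 0\<^sub>v (2 * length ps) \<and> (\<forall>f \<in> set fs. f u = 0)"
    unfolding tot_isotropic_def qdim_binary_sum by auto
  have "\<exists>u \<in> U. u \<noteq> 0\<^sub>v (2 * length ps) \<and> (\<forall>f \<in> set (map (\<lambda>k v. v $ k) ks). f u = 0)"
    by (rule U(3)) (use I in \<open>auto simp: linear_form_def\<close>)
  then obtain u where u: "u \<in> U" "u \<noteq> 0\<^sub>v (2 * length ps)" "\<forall>k \<in> set ks. u $ k = 0" by auto
  have c: "u \<in> carrier_vec (2 * length ps)" using u(1) U(1) by auto
  show thesis
  proof (rule that[of "\<lambda>k. u $ k"])
    show "\<exists>k<2 * length ps. u $ k \<noteq> 0" using u(2) c by (metis carrier_vecD eq_vecI index_zero_vec(1,2))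
  qed (use u c U(2)[OF u(1)] qval_binary_sum[OF c] in auto)
qed

section \<open>Arithmetic in characteristic two\<close>

locale char_two =
  fixes field_type :: "'a::field itself"
  assumes char_two: "CHAR('a) = 2"
begin

lemma two_eq_zero: "(2::'a) = 0"
  using of_nat_CHAR[where 'a='a] char_two by simp

lemma add_self: "x + x = (0::'a)" "x + (x + y) = (y::'a)"
proof -
  show "x + x = 0" for x :: 'a using two_eq_zero by (metis mult_2 mult_zero_left)
  then show "x + (x + y) = y" by (metis add.assoc add_0)
qed

lemma uminus_self: "- x = (x::'a)"
  using add_self(1) by (metis neg_eq_iff_add_eq_0)

lemma diff_eq_add: "x - y = x + (y::'a)"
  using uminus_self[of y] by (metis add_uminus_conv_diff)

lemmas char2_simps = add_self uminus_self diff_eq_add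

lemma add_eq_0_iff_eq: "x + y = (0::'a) \<longleftrightarrow> x = y"
  using diff_eq_add by (metis eq_iff_diff_eq_0)

lemma square_add: "(x + y)\<^sup>2 = x\<^sup>2 + (y::'a)\<^sup>2"
  by (simp add: power2_eq_square algebra_simps char2_simps)

end

section \<open>Explicit isometries in dimensions two and four\<close>

lemma less_4_cases_iff: "i < (4::nat) \<longleftrightarrow> i = 0 \<or> i = 1 \<or> i = 2 \<or> i = 3" by auto

definition vec2 :: "'a \<Rightarrow> 'a \<Rightarrow> 'a vec" where
  "vec2 x y = vec 2 (\<lambda>i. if i = 0 then x else y)"

lemma vec2_index [simp]: "vec2 x y $ 0 = x" "vec2 x y $ Suc 0 = y" "vec2 x y \<in> carrier_vec 2"
  by (auto simp: vec2_def)

lemma vec2_cases: "v \<in> carrier_vec 2 \<Longrightarrow> v = vec2 (v $ 0) (v $ 1)"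
  by (rule eq_vecI) (auto simp: vec2_def less_2_cases_iff)

lemma linear_fun_vec2:
  "linear_form n f \<Longrightarrow> linear_form n g \<Longrightarrow> linear_fun n 2 (\<lambda>v. vec2 (f v) (g v))"
  by (auto simp: linear_fun_def linear_form_def vec2_def intro!: eq_vecI)

definition vec4 :: "'a \<Rightarrow> 'a \<Rightarrow> 'a \<Rightarrow> 'a \<Rightarrow> 'a vec" where
  "vec4 x y z w = vec 4 (\<lambda>i. if i = 0 then x else if i = 1 then y else if i = 2 then z else w)"

lemma vec4_index [simp]: "vec4 x y z w $ 0 = x" "vec4 x y z w $ Suc 0 = y" "vec4 x y z w $ 2 = z"
    "vec4 x y z w $ 3 = w" "vec4 x y z w \<in> carrier_vec 4" "dim_vec (vec4 x y z w) = 4"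
  by (auto simp: vec4_def)

lemma vec4_cases: "v \<in> carrier_vec 4 \<Longrightarrow> v = vec4 (v $ 0) (v $ 1) (v $ 2) (v $ 3)"
  by (rule eq_vecI) (auto simp: vec4_def less_4_cases_iff)

lemma linear_fun_vec4:
  "linear_form n f \<Longrightarrow> linear_form n g \<Longrightarrow> linear_form n h \<Longrightarrow> linear_form n k \<Longrightarrow>
    linear_fun n 4 (\<lambda>v. vec4 (f v) (g v) (h v) (k v))"
  by (auto simp: linear_fun_def linear_form_def vec4_def intro!: eq_vecI)

lemma qval_orth_sum_2:
  assumes "qdim q = 2" "qdim r = 2" "v \<in> carrier_vec 4"
  shows "qval (q \<bottom>\<^sub>q r) v = qval q (vec2 (v $ 0) (v $ 1)) + qval r (vec2 (v $ 2) (v $ 3))"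
proof -
  have *: "v $ Suc (Suc 0) = v $ 2" "v $ Suc (Suc (Suc 0)) = v $ 3"
    by (simp_all add: numeral_2_eq_2 numeral_3_eq_3)
  have "vec_first v 2 = vec2 (v $ 0) (v $ 1)" "vec_last v 2 = vec2 (v $ 2) (v $ 3)"
    using assms(3) by (auto simp: vec_first_def vec_last_def vec2_def less_2_cases_iff *
        intro!: eq_vecI)
  then show ?thesis using assms by (simp add: qval_orth_sum)
qed

lemma qdim_hyperbolic_plane [simp]: "qdim hyperbolic_plane = 2" by (simp add: hyperbolic_plane_def)

lemma qval_vec2:
  "qval (binary_form a b) (vec2 x y) = a * x\<^sup>2 + x * y + b * y\<^sup>2"
  "qval hyperbolic_plane (vec2 x y) = x * y"
  "qval (scale_form c q) v = c * qval q v"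
  "qval (quad_pfister1 c) (vec2 x y) = x\<^sup>2 + x * y + c * y\<^sup>2"
  by (auto simp: binary_form_def hyperbolic_plane_def scale_form_def quad_pfister1_def)

text \<open>The eight equations say that the matrices with rows (a, b), (c, d) and (a', b'), (c',
  d') are inverse to each other.\<close>

lemma isometric_2I:
  fixes q r :: "'a::field qform"
  assumes "qdim q = 2" "qdim r = 2"
    and "a * a' + b * c' = 1" "a * b' + b * d' = 0" "c * a' + d * c' = 0" "c * b' + d * d' = 1"
    and "a' * a + b' * c = 1" "a' * b + b' * d = 0" "c' * a + d' * c = 0" "c' * b + d' * d = 1"
    and val: "\<And>x y. qval r (vec2 (a * x + b * y) (c * x + d * y)) = qval q (vec2 x y)"
  shows "q \<cong>\<^sub>q r"
proof (rule isometricI[of _ 2])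
  let ?f = "\<lambda>v. vec2 (a * v $ 0 + b * v $ 1) (c * v $ 0 + d * v $ 1)"
  let ?g = "\<lambda>v. vec2 (a' * v $ 0 + b' * v $ 1) (c' * v $ 0 + d' * v $ 1)"
  show "linear_fun 2 2 ?f" "linear_fun 2 2 ?g"
    by (rule linear_fun_vec2; auto simp: linear_form_def algebra_simps)+
  fix v :: "'a vec" assume v: "v \<in> carrier_vec 2"
  have lin: "p * (p1 * x + p2 * y) + q * (q1 * x + q2 * y) = (p * p1 + q * q1) * x + (p * p2 + q * q2) * y"
    for p p1 p2 q q1 q2 x y :: 'a by (simp add: algebra_simps)
  show "?f (?g v) = v" "?g (?f v) = v"
    using assms vec2_cases[OF v] by (simp_all add: lin)
  show "qval r (?f v) = qval q v" using val vec2_cases[OF v] by metis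
qed (use assms in auto)

lemma scale_zero_form [simp]: "scale_form d zero_form = zero_form"
  by (simp add: scale_form_def zero_form_def)

text \<open>The plane absorbs the scalar, as d x y = x (d y).\<close>

lemma scale_hyperbolic: "d \<noteq> 0 \<Longrightarrow> scale_form d (hyperbolic k) \<cong>\<^sub>q hyperbolic k"
proof (induction k)
  case 0
  then show ?case by (simp add: scale_form_def zero_form_def)
next
  case (Suc k)
  have "scale_form d hyperbolic_plane \<cong>\<^sub>q hyperbolic_plane"
    by (rule isometric_2I[where a=1 and b=0 and c=0 and d=d and a'=1 and b'=0 and c'=0 and d'="1/d"])
      (use Suc.prems in \<open>auto simp: qval_vec2 scale_form_def\<close>)
  then show ?case using Suc orth_sum_cong by (simp add: scale_orth_sum)
qed

lemma witt_equiv_scale_zero: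
  assumes "witt_equiv q zero_form" "d \<noteq> 0"
  shows "witt_equiv (scale_form d q) zero_form"
proof -
  obtain i j where "q \<bottom>\<^sub>q hyperbolic i \<cong>\<^sub>q zero_form \<bottom>\<^sub>q hyperbolic j"
    using assms(1) unfolding witt_equiv_def by blast
  from scale_isometric[OF this, of d]
  have "scale_form d q \<bottom>\<^sub>q scale_form d (hyperbolic i) \<cong>\<^sub>q zero_form \<bottom>\<^sub>q scale_form d (hyperbolic j)"
    by (simp add: scale_orth_sum scale_zero_form)
  then have "scale_form d q \<bottom>\<^sub>q hyperbolic i \<cong>\<^sub>q zero_form \<bottom>\<^sub>q hyperbolic j"
    using scale_hyperbolic[OF assms(2)] orth_sum_cong[OF isometric_refl]
      isometric_trans isometric_sym by meson
  then show ?thesis unfolding witt_equiv_def by blast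
qed

section \<open>Relations between the classes of binary forms\<close>

context char_two
begin

text \<open>The form a x^2 + x y = x (a x + y) is a hyperbolic plane.\<close>

lemma binary_class_zero_right: "binary_class (a::'a) 0 = 0"
proof -
  have "binary_form a 0 \<cong>\<^sub>q hyperbolic_plane"
    by (rule isometric_2I[where a=1 and b=0 and c=a and d=1 and a'=1 and b'=0 and c'="a" and d'=1])
      (auto simp: qval_vec2 power2_eq_square algebra_simps char2_simps)
  then have "binary_form a 0 \<cong>\<^sub>q hyperbolic 1"
    using isometric_trans[OF _ isometric_sym[OF orth_sum_zero_right]] by simp
  then have "witt_equiv (binary_form a 0) zero_form"
    using witt_equiv_trans[OF isometric_witt_equiv hyperbolic_witt_zero] by blast
  then show ?thesis unfolding binary_class_def abs_witt_zero[symmetric] witt.abs_eq_iff .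
qed

lemma abs_witt_isometric: "q \<cong>\<^sub>q r \<Longrightarrow> abs_witt q = abs_witt r"
  by (simp add: witt.abs_eq_iff isometric_witt_equiv)

lemma binary_class_commute: "binary_class (a::'a) b = binary_class b a"
  unfolding binary_class_def
  by (rule abs_witt_isometric,
      rule isometric_2I[where a=0 and b=1 and c=1 and d=0 and a'=0 and b'=1 and c'=1 and d'=0])
    (auto simp: qval_vec2 algebra_simps)

lemma binary_class_zero_left: "binary_class 0 (a::'a) = 0"
  using binary_class_zero_right binary_class_commute by metis

text \<open>The coordinates are scaled by \<open>x\<close> and \<open>1/x\<close>. For
  \<open>x = 0\<close> both classes are trivial.\<close>

lemma binary_class_square: "binary_class (a * x\<^sup>2) b = binary_class (a::'a) (b * x\<^sup>2)"
proof (cases "x = 0")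
  case True
  then show ?thesis by (simp add: binary_class_zero_left binary_class_zero_right)
next
  case False
  then show ?thesis unfolding binary_class_def
    by (intro abs_witt_isometric
        isometric_2I[where a=x and b=0 and c=0 and d="1/x" and a'="1/x" and b'=0 and c'=0 and d'=x])
      (auto simp: qval_vec2 field_simps power2_eq_square)
qed

text \<open>The first coordinate is shifted by \<open>b\<close> times the second. With additivity
  this says that [a, -] kills a b^2 + b, which for a = 1 is an Artin-Schreier element.\<close>

lemma binary_class_artin_schreier: "binary_class a (a * b\<^sup>2) = binary_class (a::'a) b"
  unfolding binary_class_def
  by (rule abs_witt_isometric,
      rule isometric_2I[where a=1 and b=b and c=0 and d=1 and a'=1 and b'=b and c'=0 and d'=1])
    (auto simp: qval_vec2 power2_eq_square algebra_simps char2_simps)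

text \<open>The first basis vectors of the two planes both have value \<open>a\<close>, so their sum
  is isotropic and lies in a hyperbolic plane that splits off. Together with commutativity this
  makes the class biadditive.\<close>

lemma binary_class_add_right: "binary_class (a::'a) (b + d) = binary_class a b + binary_class a d"
proof -
  have "binary_form a b \<bottom>\<^sub>q binary_form a d \<cong>\<^sub>q binary_form a (b + d) \<bottom>\<^sub>q hyperbolic_plane"
  proof (rule isometricI[of _ 4])
    let ?f = "\<lambda>v. vec4 (v $ 0 + v $ 2) (v $ 1) (v $ 2 + d * (v $ 1 + v $ 3)) (v $ 1 + v $ 3)"
    let ?g = "\<lambda>v. vec4 (v $ 0 + v $ 2 + d * v $ 3) (v $ 1) (v $ 2 + d * v $ 3) (v $ 1 + v $ 3)"
    show "linear_fun 4 4 ?f" "linear_fun 4 4 ?g"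
      by (rule linear_fun_vec4; auto simp: linear_form_def algebra_simps)+
    fix v :: "'a vec" assume v: "v \<in> carrier_vec 4"
    obtain x y z w where vv: "v = vec4 x y z w" using vec4_cases[OF v] by blast
    show "?f (?g v) = v" "?g (?f v) = v"
      unfolding vv by (simp_all add: algebra_simps char2_simps)
    show "qval (binary_form a (b + d) \<bottom>\<^sub>q hyperbolic_plane) (?f v) = qval (binary_form a b \<bottom>\<^sub>q binary_form a d) v"
      unfolding vv by (simp add: qval_orth_sum_2 qval_vec2 power2_eq_square algebra_simps char2_simps)
  qed auto
  then have "abs_witt (binary_form a b) + abs_witt (binary_form a d) =
      abs_witt (binary_form a (b + d)) + abs_witt hyperbolic_plane"
    using abs_witt_isometric by (metis abs_witt_orth_sum)
  moreover have "abs_witt hyperbolic_plane = (0 :: 'a witt)"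
    unfolding abs_witt_zero[symmetric]
    using abs_witt_isometric[OF orth_sum_zero_right, of "hyperbolic_plane :: 'a qform"]
      hyperbolic_witt_zero[of 1, where 'a='a] by (simp add: witt.abs_eq_iff[symmetric])
  ultimately show ?thesis unfolding binary_class_def by simp
qed

lemma binary_class_add_left: "binary_class (a + d) (b::'a) = binary_class a b + binary_class d b"
  using binary_class_add_right binary_class_commute by metis

lemma binary_class_self: "binary_class (a::'a) b + binary_class a b = 0" "binary_class (a::'a) b + (binary_class a b + z) = z"
proof -
  show "binary_class a b + binary_class a b = 0" using binary_class_add_right[of a b b] by (simp add: char2_simps binary_class_zero_right)
  then show "binary_class a b + (binary_class a b + z) = z" by (metis add.assoc add_0)
qed

lemma abs_witt_scale_binary: "d \<noteq> 0 \<Longrightarrow> abs_witt (scale_form d (binary_form a b)) = binary_class (d * a) (b / (d::'a))"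
  unfolding binary_class_def
  by (rule abs_witt_isometric,
      rule isometric_2I[where a=1 and b=0 and c=0 and d=d and a'=1 and b'=0 and c'=0 and d'="1/d"])
    (auto simp: qval_vec2 scale_form_def field_simps power2_eq_square)

lemma abs_witt_scale_binary_sum:
  "d \<noteq> 0 \<Longrightarrow> abs_witt (scale_form d (binary_sum ps)) = (\<Sum>(a, b)\<leftarrow>ps. binary_class (d * a) (b / (d::'a)))"
proof (induction ps)
  case Nil
  show ?case by (simp add: binary_sum_def abs_witt_zero)
next
  case (Cons p ps)
  obtain a b where "p = (a, b)" by fastforce
  then show ?case using Cons
    by (simp add: binary_sum_def scale_orth_sum abs_witt_orth_sum abs_witt_scale_binary)
qed

text \<open>A relation is scaled as a whole: the form representing the sum is Witt trivial, hence so
  is its multiple by \<open>d\<close>, and d [a, b] is isometric to [da, b/d].\<close>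

lemma binary_class_sum_scale:
  assumes "(\<Sum>(a, b)\<leftarrow>ps. binary_class a b) = 0" "d \<noteq> (0::'a)"
  shows "(\<Sum>(a, b)\<leftarrow>ps. binary_class (d * a) (b / d)) = 0"
proof -
  have "witt_equiv (binary_sum ps) zero_form"
    using assms(1) unfolding abs_witt_binary_sum[symmetric] abs_witt_zero[symmetric] witt.abs_eq_iff .
  then have "abs_witt (scale_form d (binary_sum ps)) = 0"
    using witt_equiv_scale_zero[OF _ assms(2)] unfolding abs_witt_zero[symmetric] witt.abs_eq_iff by blast
  then show ?thesis using abs_witt_scale_binary_sum assms(2) by metis
qed

end

section \<open>Relations between classes of Pfister forms\<close>

text \<open>The class of \<open>g[1, e] \<cong> [g, e/g]\<close>. Thus \<open>pfister2_class f e\<close> is the class of the norm form of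
  \<open>[e, f)\<close>, and \<open>pfister3_class f g e\<close> is that of \<open>\<langle>\<langle>f, g, e]]\<close>.\<close>

definition pfister1_class :: "'a::field \<Rightarrow> 'a \<Rightarrow> 'a witt" where
  "pfister1_class g e = binary_class g (e / g)"

definition pfister2_class :: "'a::field \<Rightarrow> 'a \<Rightarrow> 'a witt" where
  "pfister2_class f e = pfister1_class 1 e + pfister1_class f e"

definition pfister3_class :: "'a::field \<Rightarrow> 'a \<Rightarrow> 'a \<Rightarrow> 'a witt" where
  "pfister3_class f g e = pfister1_class 1 e + (pfister1_class f e + (pfister1_class g e + pfister1_class (f * g) e))"

text \<open>The norm of x + y w in the quadratic algebra generated by w with w^2 + w = e.\<close>

definition nrm :: "'a::field \<Rightarrow> 'a \<Rightarrow> 'a \<Rightarrow> 'a" where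
  "nrm e x y = x\<^sup>2 + x * y + e * y\<^sup>2"

section \<open>One-fold classes and norms\<close>

context char_two
begin

lemma pfister1_class_self: "pfister1_class (g::'a) e + pfister1_class g e = 0" "pfister1_class (g::'a) e + (pfister1_class g e + z) = z"
  by (simp_all add: pfister1_class_def binary_class_self)

lemma pfister1_class_add: "pfister1_class (g::'a) (d + e) = pfister1_class g d + pfister1_class g e"
  by (simp add: pfister1_class_def add_divide_distrib binary_class_add_right)

lemma pfister2_class_add: "pfister2_class (g::'a) (d + e) = pfister2_class g d + pfister2_class g e"
  by (simp add: pfister2_class_def pfister1_class_add add_ac)

lemma pfister1_class_square: "k \<noteq> 0 \<Longrightarrow> pfister1_class (g * k\<^sup>2) e = pfister1_class (g::'a) e"
  by (simp add: pfister1_class_def binary_class_square)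

text \<open>Norms are similarity factors of [1, e]. Removing the square y^2 reduces to a norm m =
  x^2 + x + e. With \<open>h = g * m\<close>, an Artin-Schreier change turns [h, e/h] into [h, 1/g];
  after swapping the entries, a second one turns h into g e, and [1/g, g e] is [g, e/g].\<close>

lemma pfister1_class_nrm:
  assumes g: "(g::'a) \<noteq> 0" and n: "nrm e x y \<noteq> 0"
  shows "pfister1_class (g * nrm e x y) e = pfister1_class g e"
proof -
  have main: "pfister1_class (g * m) e = pfister1_class g e" if m: "m = x\<^sup>2 + x + e" "m \<noteq> 0" for m x :: 'a
  proof -
    define h where "h = g * m"
    have h: "h \<noteq> 0" using g m by (simp add: h_def)
    have "e = m + (x\<^sup>2 + x)" using m(1) by (simp add: add_ac char2_simps)
    then have "e / h = m / h + (x\<^sup>2 / h + x / h)" by (metis add_divide_distrib)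
    moreover have "m / h = 1 / g" using g m(2) by (simp add: h_def)
    moreover have "x\<^sup>2 / h = h * (x / h)\<^sup>2" using h by (simp add: power2_eq_square)
    ultimately have "e / h = 1 / g + (h * (x / h)\<^sup>2 + x / h)" by simp
    then have "binary_class h (e / h) = binary_class h (1 / g)"
      by (simp only: binary_class_add_right binary_class_artin_schreier binary_class_self) simp
    also have "\<dots> = binary_class (1 / g) (g * e + ((1 / g) * (g * x)\<^sup>2 + g * x))"
      using g m by (subst binary_class_commute) (simp add: h_def algebra_simps power2_eq_square)
    also have "\<dots> = binary_class (1 / g) (g * e)"
      by (simp only: binary_class_add_right binary_class_artin_schreier binary_class_self) simp
    also have "\<dots> = binary_class (1 / g) ((e / g) * g\<^sup>2)" using g by (simp add: power2_eq_square mult.commute)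
    also have "\<dots> = binary_class ((1 / g) * g\<^sup>2) (e / g)" by (rule binary_class_square[symmetric])
    also have "(1 / g) * g\<^sup>2 = g" using g by (simp add: power2_eq_square)
    finally show ?thesis by (simp add: pfister1_class_def h_def)
  qed
  show ?thesis
  proof (cases "y = 0")
    case True
    then show ?thesis using n by (simp add: nrm_def pfister1_class_square)
  next
    case False
    have eq: "nrm e x y = ((x / y)\<^sup>2 + x / y + e) * y\<^sup>2"
      using False by (simp add: nrm_def field_simps power2_eq_square)
    then have "pfister1_class (g * nrm e x y) e = pfister1_class (g * ((x / y)\<^sup>2 + x / y + e) * y\<^sup>2) e" by (simp add: mult.assoc)
    also have "\<dots> = pfister1_class g e" using main[OF refl, of "x / y"] pfister1_class_square[OF False] n eq by auto
    finally show ?thesis .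
  qed
qed

text \<open>An isotropic vector gives e = z^2 + z with z = x / y, so that e / g has the form g b^2 +
  b killed by [g, -]. For \<open>g = 0\<close> the quotient \<open>e / g\<close> is zero by
  convention.\<close>

lemma pfister1_class_isotropic:
  assumes "nrm e x y = 0" "x \<noteq> 0 \<or> y \<noteq> 0"
  shows "pfister1_class (g::'a) e = 0"
proof (cases "g = 0")
  case True
  then show ?thesis by (simp add: pfister1_class_def binary_class_zero_right)
next
  case g: False
  have y: "y \<noteq> 0" using assms by (auto simp: nrm_def)
  define z where "z = x / y"
  have "nrm e x y = (z\<^sup>2 + z + e) * y\<^sup>2" using y by (simp add: nrm_def z_def field_simps power2_eq_square)
  then have "z\<^sup>2 + z + e = 0" using assms(1) y by simp
  then have "e = z\<^sup>2 + z" using add_eq_0_iff_eq by metis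
  then have "e / g = g * (z / g)\<^sup>2 + z / g" using g by (simp add: field_simps power2_eq_square)
  then show ?thesis by (simp only: pfister1_class_def binary_class_add_right binary_class_artin_schreier binary_class_self)
qed

text \<open>The analogue of \<open>\<langle>x, y\<rangle> \<cong> \<langle>x + y, xy(x + y)\<rangle>\<close> for bilinear forms.\<close>

lemma pfister1_class_plus:
  assumes "x \<noteq> 0" "y \<noteq> 0" "x + y \<noteq> (0::'a)"
  shows "pfister1_class x e + pfister1_class y e = pfister1_class (x + y) e + pfister1_class (x * y * (x + y)) e"
proof -
  define z where "z = x + y"
  have z: "z \<noteq> 0" using assms z_def by simp
  have yz: "y = z + x" by (simp add: z_def add_ac char2_simps)
  have sq: "binary_class (a\<^sup>2 / z) (e / a) = binary_class z (e * a / z\<^sup>2)" if "a \<noteq> 0" for a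
  proof -
    have "binary_class (a\<^sup>2 / z) (e / a) = binary_class (z * (a / z)\<^sup>2) (e / a)" using z by (simp add: field_simps power2_eq_square)
    also have "\<dots> = binary_class z (e / a * (a / z)\<^sup>2)" by (rule binary_class_square)
    also have "e / a * (a / z)\<^sup>2 = e * a / z\<^sup>2" using that by (simp add: field_simps power2_eq_square)
    finally show ?thesis .
  qed
  \<comment> \<open>The second entry e / (x y / z) splits as e/x + e/y. The first entry is written
    differently against each summand, so that [x, e/x] and [y, e/y] come out; the remainders add up
    to [z, e/z].\<close>
  have 1: "x * y / z = x + x\<^sup>2 / z" "x * y / z = y + y\<^sup>2 / z"
  proof -
    have "x + x\<^sup>2 / z = x * (z + x) / z" using z by (simp add: field_simps power2_eq_square)
    also have "z + x = y" using yz by simp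
    finally show "x * y / z = x + x\<^sup>2 / z" by simp
    have "y + y\<^sup>2 / z = y * (z + y) / z" using z by (simp add: field_simps power2_eq_square)
    also have "z + y = x" by (simp add: z_def add_ac char2_simps)
    finally show "x * y / z = y + y\<^sup>2 / z" by simp
  qed
  have "x * y * z = x * y / z * z\<^sup>2" using z by (simp add: power2_eq_square)
  then have "pfister1_class (x * y * z) e = pfister1_class (x * y / z) e" using pfister1_class_square[OF z, of "x * y / z" e] by simp
  also have "\<dots> = binary_class (x * y / z) (e / x + e / y)"
  proof -
    have "e / (x * y / z) = e / x + e / y" using assms z by (simp add: z_def field_simps)
    then show ?thesis by (simp add: pfister1_class_def)
  qed
  also have "\<dots> = binary_class (x + x\<^sup>2 / z) (e / x) + binary_class (y + y\<^sup>2 / z) (e / y)"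
    using 1 by (simp add: binary_class_add_right)
  also have "\<dots> = (binary_class x (e / x) + binary_class z (e * x / z\<^sup>2)) + (binary_class y (e / y) + binary_class z (e * y / z\<^sup>2))"
    by (simp only: binary_class_add_left sq[OF assms(1)] sq[OF assms(2)])
  also have "\<dots> = pfister1_class x e + pfister1_class y e + binary_class z (e * x / z\<^sup>2 + e * y / z\<^sup>2)"
    by (simp add: pfister1_class_def binary_class_add_right add_ac)
  also have "e * x / z\<^sup>2 + e * y / z\<^sup>2 = e * (x + y) / z\<^sup>2"
    by (simp add: algebra_simps add_divide_distrib)
  also have "e * (x + y) / z\<^sup>2 = e / z"
    using z by (simp add: z_def[symmetric] power2_eq_square)
  finally have "pfister1_class (x * y * z) e = pfister1_class x e + pfister1_class y e + pfister1_class z e" by (simp add: pfister1_class_def)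
  then show ?thesis by (simp add: z_def[symmetric] add_ac pfister1_class_self)
qed

section \<open>Slots read off from isotropic vectors\<close>

lemma mult_nrm: "f \<noteq> 0 \<Longrightarrow> f * nrm e x (y / f) = f * x\<^sup>2 + x * y + e / f * y\<^sup>2" for f :: 'a
  by (simp add: nrm_def field_simps power2_eq_square)

lemma pfister1_class_represented:
  assumes f: "f \<noteq> 0" and 0: "r\<^sup>2 + f * nrm e x y = 0" and nz: "r \<noteq> 0 \<or> x \<noteq> 0 \<or> y \<noteq> 0" and g: "g \<noteq> (0::'a)"
  shows "pfister1_class (g * f) e = pfister1_class g e"
proof (cases "nrm e x y = 0")
  case True
  then show ?thesis using 0 nz pfister1_class_isotropic by auto
next
  case False
  have "f * nrm e x y = r\<^sup>2" using 0 add_eq_0_iff_eq by metis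
  then have "g * f * nrm e x y = g * r\<^sup>2" "r \<noteq> 0" using f False by (auto simp: mult.assoc)
  then show ?thesis using pfister1_class_nrm[of "g * f"] pfister1_class_square f g False by (metis mult_eq_0_iff)
qed

text \<open>If [e, f) splits, then \<open>f\<close> is a norm. Of the two planes [1, e] and
  [f, e/f], the second coordinate of the first may be killed, which leaves r^2 + f N = 0 with a
  value N of \<open>nrm e\<close>.\<close>

lemma pfister2_class_zero:
  assumes f: "f \<noteq> 0" and 0: "pfister2_class f e = 0" and g: "g \<noteq> (0::'a)"
  shows "pfister1_class (g * f) e = pfister1_class g e"
proof -
  define ps where "ps = [(1, e), (f, e / f)]"
  have "(\<Sum>(a, b)\<leftarrow>ps. binary_class a b) = 0" using 0 by (simp add: ps_def pfister2_class_def pfister1_class_def)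
  then obtain v :: "nat \<Rightarrow> 'a" where v': "\<exists>k < 2 * length ps. v k \<noteq> 0" "\<And>k. k \<in> set [1] \<Longrightarrow> v k = 0"
    "(\<Sum>i<length ps. fst (ps ! i) * (v (2 * i))\<^sup>2 + v (2 * i) * v (Suc (2 * i)) +
       snd (ps ! i) * (v (Suc (2 * i)))\<^sup>2) = 0"
    by (rule witt_zero_isotropic[where ks = "[1]"]) (auto simp: ps_def)
  have v: "\<exists>k<4. v k \<noteq> 0" "v 1 = 0" using v'(1,2) by (auto simp: ps_def)
  have "(v 0)\<^sup>2 + f * nrm e (v 2) (v 3 / f) = 0"
    using v(2) v'(3) f
    by (simp add: ps_def mult_nrm numeral_eq_Suc lessThan_Suc add_ac)
  moreover have "v 0 \<noteq> 0 \<or> v 2 \<noteq> 0 \<or> v 3 / f \<noteq> 0"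
    using v(1,2) f by (auto simp: less_4_cases_iff)
  ultimately show ?thesis using pfister1_class_represented f g by blast
qed

text \<open>In the sum of the two classes, [1, e] and [1, \<alpha>] merge into one plane. Three
  planes remain, so two coordinates may be killed: r^2 + \<beta> s^2 + f N = 0. After division by
  s^2, \<open>f\<close> times a norm equals \<beta> plus a square. The trivial alternative collects
  the degenerate cases s = 0 and f' = 0.\<close>

lemma pfister2_class_slot:
  assumes f: "f \<noteq> 0" and \<beta>: "\<beta> \<noteq> 0" and eq: "pfister2_class \<beta> \<alpha> = pfister2_class f (e::'a)"
  obtains (trivial) "\<And>g. g \<noteq> 0 \<Longrightarrow> pfister1_class (g * f) e = pfister1_class g e"
  | (slot) r f' where "f' \<noteq> 0" "f' = \<beta> + r\<^sup>2" "\<And>g. g \<noteq> 0 \<Longrightarrow> pfister1_class (g * f) e = pfister1_class (g * f') e"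
proof -
  have *: "binary_class 1 e + (binary_class 1 \<alpha> + (binary_class \<beta> (\<alpha> / \<beta>) + binary_class f (e / f))) = 0"
    using arg_cong[OF eq, of "\<lambda>z. z + pfister2_class f e"]
    by (simp add: pfister2_class_def pfister1_class_def add_ac binary_class_self)
  define ps where "ps = [(1, e + \<alpha>), (\<beta>, \<alpha> / \<beta>), (f, e / f)]"
  have "(\<Sum>(a, b)\<leftarrow>ps. binary_class a b) = 0" using * by (simp add: ps_def binary_class_add_right add_ac)
  then obtain v :: "nat \<Rightarrow> 'a" where v': "\<exists>k < 2 * length ps. v k \<noteq> 0" "\<And>k. k \<in> set [1, 3] \<Longrightarrow> v k = 0"
    "(\<Sum>i<length ps. fst (ps ! i) * (v (2 * i))\<^sup>2 + v (2 * i) * v (Suc (2 * i)) +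
       snd (ps ! i) * (v (Suc (2 * i)))\<^sup>2) = 0"
    by (rule witt_zero_isotropic[where ks = "[1, 3]"]) (auto simp: ps_def)
  have v: "\<exists>k<6. v k \<noteq> 0" "v 1 = 0" "v 3 = 0" using v'(1,2) by (auto simp: ps_def)
  define r s x y where "r = v 0" "s = v 2" "x = v 4" "y = v 5 / f"
  have 0: "r\<^sup>2 + \<beta> * s\<^sup>2 + f * nrm e x y = 0"
    using v(2,3) v'(3) f
    by (simp add: ps_def r_s_x_y_def mult_nrm numeral_eq_Suc lessThan_Suc add_ac)
  have nz: "r \<noteq> 0 \<or> s \<noteq> 0 \<or> x \<noteq> 0 \<or> y \<noteq> 0"
  proof -
    obtain k where k: "k < 6" "v k \<noteq> 0" using v(1) by auto
    then have "k = 0 \<or> k = 1 \<or> k = 2 \<or> k = 3 \<or> k = 4 \<or> k = 5" by auto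
    then show ?thesis using k(2) v(2,3) f by (auto simp: r_s_x_y_def)
  qed
  show thesis
  proof (cases "s = 0")
    case True
    then show ?thesis using pfister1_class_represented[OF f] 0 nz trivial by auto
  next
    case s: False
    define f' where "f' = f * nrm e (x / s) (y / s)"
    have "(r / s)\<^sup>2 + \<beta> + f' = (r\<^sup>2 + \<beta> * s\<^sup>2 + f * nrm e x y) / s\<^sup>2"
      using s by (simp add: f'_def nrm_def field_simps power2_eq_square)
    then have "(r / s)\<^sup>2 + \<beta> + f' = 0" using 0 by simp
    then have f': "f' = \<beta> + (r / s)\<^sup>2" using add_eq_0_iff_eq by (metis add.commute)
    show ?thesis
    proof (cases "f' = 0")
      case False
      then have "pfister1_class (g * f) e = pfister1_class (g * f') e" if "g \<noteq> 0" for g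
        using pfister1_class_nrm[of "g * f" e "x / s" "y / s"] that f by (simp add: f'_def mult.assoc)
      then show ?thesis using slot f' False by blast
    next
      case True
      \<comment> \<open>Now \<beta> is a square, so the common class of the two algebras is
        zero.\<close>
      then have \<beta>2: "\<beta> = 1 * (r / s)\<^sup>2" using f' add_eq_0_iff_eq by simp
      then have "r / s \<noteq> 0" using \<beta> by auto
      then have "pfister1_class \<beta> \<alpha> = pfister1_class 1 \<alpha>" using pfister1_class_square \<beta>2 by metis
      then have "pfister2_class f e = 0" using eq by (simp add: pfister2_class_def pfister1_class_self)
      then show ?thesis using pfister2_class_zero[OF f] trivial by blast
    qed
  qed
qed

text \<open>The slot \<open>\<beta>\<close> turns \<open>f1, f2\<close> into \<open>\<beta> + r1\<^sup>2, \<beta> + r2\<^sup>2\<close>, whose sum is a square, so the bilinear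
  form \<open>\<langle>\<langle>f1, f2\<rangle>\<rangle>\<close> becomes metabolic.\<close>

lemma common_slots:
  assumes f: "f1 \<noteq> 0" "f2 \<noteq> 0" and \<beta>: "\<beta> \<noteq> 0" and g: "g \<noteq> 0"
    and eq: "pfister2_class \<beta> \<alpha>1 = pfister2_class f1 (e::'a)" "pfister2_class \<beta> \<alpha>2 = pfister2_class f2 e"
  shows "pfister1_class g e + (pfister1_class (g * f1) e + (pfister1_class (g * f2) e + pfister1_class (g * f1 * f2) e)) = 0"
proof (cases rule: pfister2_class_slot[OF f(1) \<beta> eq(1)])
  case 1
  then have "pfister1_class (g * f1) e = pfister1_class g e" "pfister1_class (g * f2 * f1) e = pfister1_class (g * f2) e" using g f by auto
  then show ?thesis by (simp add: pfister1_class_self mult_ac)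
next
  case s1: (2 r1 f1')
  show ?thesis
  proof (cases rule: pfister2_class_slot[OF f(2) \<beta> eq(2)])
    case 1
    then have "pfister1_class (g * f2) e = pfister1_class g e" "pfister1_class (g * f1 * f2) e = pfister1_class (g * f1) e" using g f by auto
    then show ?thesis by (simp add: pfister1_class_self add_ac)
  next
    case s2: (2 r2 f2')
    have T: "pfister1_class (g * f1) e = pfister1_class (g * f1') e" "pfister1_class (g * f2) e = pfister1_class (g * f2') e"
      "pfister1_class (g * f1 * f2) e = pfister1_class (g * f1' * f2') e"
      using s1(3)[of g] s2(3)[of g] s2(3)[of "g * f1"] s1(3)[of "g * f2'"] g f s2(1)
      by (auto simp: mult_ac)
    define \<rho> where "\<rho> = r1 + r2"
    have sum: "f1' + f2' = \<rho>\<^sup>2" by (simp add: s1 s2 \<rho>_def square_add add_ac char2_simps)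
    show ?thesis
    proof (cases "\<rho> = 0")
      case True
      then have "f1' = f2'" using sum add_eq_0_iff_eq by simp
      then show ?thesis using T pfister1_class_square[OF s1(1), of g e]
        by (simp add: power2_eq_square mult.assoc pfister1_class_self)
    next
      case False
      have p: "g * f1' + g * f2' = g * \<rho>\<^sup>2" using sum by (metis distrib_left)
      \<comment> \<open>Modulo squares, the sum of g f1' and g f2' is g, and their product times
        that sum is g f1' f2'. Hence the diagonal form with entries g f1', g f2' may be replaced by
        the one with entries g, g f1' f2'.\<close>
      have q: "(g * f1') * (g * f2') * (g * \<rho>\<^sup>2) = g * f1' * f2' * (g * \<rho>)\<^sup>2"
        by (simp only: power2_eq_square mult_ac)
      have "pfister1_class (g * f1') e + pfister1_class (g * f2') e =
          pfister1_class (g * \<rho>\<^sup>2) e + pfister1_class ((g * f1') * (g * f2') * (g * \<rho>\<^sup>2)) e"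
        using pfister1_class_plus[of "g * f1'" "g * f2'" e] g s1(1) s2(1) False p by simp
      then have "pfister1_class (g * f1') e + pfister1_class (g * f2') e =
          pfister1_class (g * \<rho>\<^sup>2) e + pfister1_class (g * f1' * f2' * (g * \<rho>)\<^sup>2) e" unfolding q .
      also have "\<dots> = pfister1_class g e + pfister1_class (g * f1' * f2') e"
        using False g by (simp add: pfister1_class_square)
      finally have *: "pfister1_class (g * f1') e + pfister1_class (g * f2') e = pfister1_class g e + pfister1_class (g * f1' * f2') e" .
      have "pfister1_class g e + (pfister1_class (g * f1) e + (pfister1_class (g * f2) e + pfister1_class (g * f1 * f2) e))
          = pfister1_class g e + pfister1_class (g * f1' * f2') e + (pfister1_class (g * f1') e + pfister1_class (g * f2') e)"
        by (simp add: T add_ac)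
      also have "\<dots> = 0" unfolding * by (simp add: add_ac pfister1_class_self)
      finally show ?thesis .
    qed
  qed
qed

text \<open>This is the vanishing of \<pi> for algebras that share both a separable entry
  \<open>e\<close> and an inseparable slot \<beta>.\<close>

lemma common_slots_zero:
  assumes "f1 \<noteq> 0" "f2 \<noteq> 0" "\<beta> \<noteq> 0"
    and "pfister2_class \<beta> \<alpha>1 = pfister2_class f1 (e::'a)" "pfister2_class \<beta> \<alpha>2 = pfister2_class f2 e"
  shows "pfister3_class f1 f2 e = 0"
  using common_slots[OF assms(1,2,3) one_neq_zero assms(4,5)] by (simp add: pfister3_class_def)

lemma pfister3_class_eq: "pfister3_class (f::'a) g e = pfister2_class f e + (pfister2_class g e + pfister2_class (f * g) e)"
  by (simp add: pfister3_class_def pfister2_class_def add_ac pfister1_class_self)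

lemma pfister2_class_self: "pfister2_class (f::'a) e + pfister2_class f e = 0" "pfister2_class f e + (pfister2_class f e + z) = z"
  by (simp_all add: pfister2_class_def add_ac pfister1_class_self)

text \<open>Two additions agree: over the slot \<beta> the separable entries add up, over the entry
  \<open>e\<close> the slots multiply. The difference of the two is <<f1, f2, e]], which
  vanishes.\<close>

lemma common_slots_sum:
  assumes "f1 \<noteq> 0" "f2 \<noteq> 0" "\<beta> \<noteq> 0"
    and "pfister2_class \<beta> \<alpha>1 = pfister2_class f1 (e::'a)" "pfister2_class \<beta> \<alpha>2 = pfister2_class f2 e"
  shows "pfister2_class \<beta> (\<alpha>1 + \<alpha>2) = pfister2_class (f1 * f2) e"
proof -
  have "pfister2_class f1 e + (pfister2_class f2 e + pfister2_class (f1 * f2) e) = 0"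
    using common_slots_zero[OF assms] by (simp add: pfister3_class_eq)
  then have "pfister2_class f1 e + pfister2_class f2 e + pfister2_class (f1 * f2) e + pfister2_class (f1 * f2) e = pfister2_class (f1 * f2) e"
    by (simp add: add.assoc)
  then have "pfister2_class f1 e + pfister2_class f2 e = pfister2_class (f1 * f2) e"
    by (simp add: add.assoc pfister2_class_self)
  then show ?thesis using assms(4,5) by (simp add: pfister2_class_add)
qed

text \<open>Nonzero values of <<f, e]] are similarity factors of it. If both partial norms m and k
  are nonzero, the planes belonging to g m and g f k are transformed by
  \<open>pfister1_class_plus\<close>, whereupon m, k and g^2 disappear as norms and a
  square.\<close>

lemma pfister2_class_nrm:
  assumes f: "f \<noteq> 0" and g: "(g::'a) \<noteq> 0" and n: "nrm e x y + f * nrm e z w \<noteq> 0"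
  shows "pfister1_class (g * (nrm e x y + f * nrm e z w)) e + pfister1_class (g * (nrm e x y + f * nrm e z w) * f) e =
    pfister1_class g e + pfister1_class (g * f) e"
proof -
  define m k where "m = nrm e x y" "k = nrm e z w"
  have M: "pfister1_class (h * m) e = pfister1_class h e" if "h \<noteq> 0" "m \<noteq> 0" for h
    using that pfister1_class_nrm m_k_def by auto
  have K: "pfister1_class (h * k) e = pfister1_class h e" if "h \<noteq> 0" "k \<noteq> 0" for h
    using that pfister1_class_nrm m_k_def by auto
  consider "m = 0" | "k = 0" | "m \<noteq> 0" "k \<noteq> 0" by blast
  then have "pfister1_class (g * (m + f * k)) e + pfister1_class (g * (m + f * k) * f) e = pfister1_class g e + pfister1_class (g * f) e"
  proof cases
    case 1
    then have k: "k \<noteq> 0" using n m_k_def by auto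
    have T: "pfister1_class (g * f * k) e = pfister1_class (g * f) e" "pfister1_class (g * f\<^sup>2 * k) e = pfister1_class g e"
      using K k f g pfister1_class_square[OF f] by auto
    have "g * (m + f * k) = g * f * k" "g * (m + f * k) * f = g * f\<^sup>2 * k"
      using 1 by (simp_all add: power2_eq_square mult_ac)
    then show ?thesis by (simp only: T add.commute)
  next
    case 2
    then have m: "m \<noteq> 0" using n m_k_def by auto
    have T: "pfister1_class (g * m) e = pfister1_class g e" "pfister1_class (g * f * m) e = pfister1_class (g * f) e"
      using M m f g by auto
    have "g * (m + f * k) = g * m" "g * (m + f * k) * f = g * f * m"
      using 2 by (simp_all add: mult_ac)
    then show ?thesis by (simp only: T)
  next
    case 3
    let ?s = "m + f * k"
    have s: "?s \<noteq> 0" using n m_k_def by simp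
    have "pfister1_class g e + pfister1_class (g * f) e = pfister1_class (g * m) e + pfister1_class (g * f * k) e"
      using M[OF g] K[of "g * f"] 3 f g by simp
    also have "\<dots> = pfister1_class (g * m + g * f * k) e + pfister1_class ((g * m) * (g * f * k) * (g * m + g * f * k)) e"
      using s f g 3 by (intro pfister1_class_plus) (auto simp: mult.assoc distrib_left[symmetric])
    also have "g * m + g * f * k = g * ?s" by (simp add: algebra_simps)
    also have "(g * m) * (g * f * k) * (g * ?s) = (g * ?s * f * m * k) * g\<^sup>2"
      by (simp only: power2_eq_square mult_ac)
    also have "pfister1_class \<dots> e = pfister1_class (g * ?s * f) e"
      using g f s 3 pfister1_class_square[OF g] K[of "g * ?s * f * m"] M[of "g * ?s * f"] by simp
    finally show ?thesis by simp
  qed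
  then show ?thesis by (simp add: m_k_def)
qed

text \<open>Similar two-fold Pfister forms have the same class. Four planes allow three coordinates
  to be killed, chosen such that \<open>l\<close> times a value of <<f, e]] equals \<open>m\<close>
  times a square. A nonzero value is a similarity factor and absorbs the scalars; if it is zero,
  both forms turn out to be trivial.\<close>

lemma pfister2_class_similar:
  assumes nz: "f \<noteq> 0" "f2 \<noteq> 0" "l \<noteq> 0" "m \<noteq> (0::'a)"
    and eq: "pfister1_class l e + pfister1_class (l * f) e = pfister1_class m d + pfister1_class (m * f2) d"
  shows "pfister2_class f e = pfister2_class f2 d"
proof -
  define ps where "ps = [(l, e / l), (l * f, e / (l * f)), (m, d / m), (m * f2, d / (m * f2))]"
  have eq0: "pfister1_class l e + (pfister1_class (l * f) e + (pfister1_class m d + pfister1_class (m * f2) d)) = 0"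
    using arg_cong[OF eq, of "\<lambda>z. z + (pfister1_class m d + pfister1_class (m * f2) d)"] by (simp add: add_ac pfister1_class_self)
  then have "(\<Sum>(a, b)\<leftarrow>ps. binary_class a b) = 0" by (simp add: ps_def pfister1_class_def)
  then obtain v :: "nat \<Rightarrow> 'a" where v': "\<exists>k < 2 * length ps. v k \<noteq> 0" "\<And>k. k \<in> set [5,6,7] \<Longrightarrow> v k = 0"
    "(\<Sum>i<length ps. fst (ps ! i) * (v (2 * i))\<^sup>2 + v (2 * i) * v (Suc (2 * i)) +
       snd (ps ! i) * (v (Suc (2 * i)))\<^sup>2) = 0"
    by (rule witt_zero_isotropic[where ks = "[5,6,7]"]) (auto simp: ps_def)
  have v: "\<exists>k<8. v k \<noteq> 0" "v 5 = 0" "v 6 = 0" "v 7 = 0" using v'(1,2) by (auto simp: ps_def)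
  define x y z w where "x = v 0" "y = v 1 / l" "z = v 2" "w = v 3 / (l * f)"
  let ?n = "nrm e x y + f * nrm e z w"
  have "l * nrm e x y + ((l * f) * nrm e z w + m * (v 4)\<^sup>2) = 0"
    using v(2,3,4) v'(3) nz unfolding x_y_z_w_def
    by (subst mult_nrm, simp, subst mult_nrm, simp)
      (simp add: ps_def numeral_eq_Suc lessThan_Suc add_ac)
  then have "l * ?n + m * (v 4)\<^sup>2 = 0" by (simp add: algebra_simps)
  then have n: "l * ?n = m * (v 4)\<^sup>2" using add_eq_0_iff_eq by metis
  have scale: "pfister1_class (c * l) e + (pfister1_class (c * l * f) e + (pfister1_class (c * m) d + pfister1_class (c * m * f2) d)) = 0"
    if "c \<noteq> 0" for c
    using binary_class_sum_scale[OF \<open>(\<Sum>(a, b)\<leftarrow>ps. binary_class a b) = 0\<close> that] nz that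
    by (simp add: ps_def pfister1_class_def mult_ac divide_divide_eq_left)
  show ?thesis
  proof (cases "?n = 0")
    case False
    then have v4: "v 4 \<noteq> 0" using n nz by auto
    define c where "c = 1 / m"
    have c: "c \<noteq> 0" "c * m = 1" using nz by (auto simp: c_def)
    \<comment> \<open>Since \<open>c * l * ?n\<close> is a square and \<open>?n\<close> is a
      similarity factor, \<open>c * l\<close> times <<f, e]] has the class of <<f, e]], while
      \<open>c * m = 1\<close> frees the other form from its scalar.\<close>
    have "c * l * ?n = (v 4)\<^sup>2" "c * l * ?n * f = f * (v 4)\<^sup>2"
      using n c(2) by (metis mult.assoc mult_1, metis mult.assoc mult.commute mult_1)
    then have "pfister1_class (c * l) e + pfister1_class (c * l * f) e = pfister1_class (1 * (v 4)\<^sup>2) e + pfister1_class (f * (v 4)\<^sup>2) e"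
      using pfister2_class_nrm[OF nz(1) _ False, of "c * l"] c(1) nz(3)
      by (simp add: mult.commute[of f])
    also have "\<dots> = pfister2_class f e" by (simp only: pfister1_class_square[OF v4] pfister2_class_def)
    finally have P: "pfister1_class (c * l) e + pfister1_class (c * l * f) e = pfister2_class f e" .
    have "(pfister1_class (c * l) e + pfister1_class (c * l * f) e) + pfister2_class f2 d = 0"
      using scale[OF c(1)] c(2) by (simp add: pfister2_class_def add.assoc)
    then have "pfister2_class f e + pfister2_class f2 d = 0" unfolding P .
    then have "pfister2_class f e + (pfister2_class f2 d + pfister2_class f2 d) = pfister2_class f2 d" by (simp add: add.assoc[symmetric])
    then show ?thesis by (simp add: pfister2_class_self)
  next
    case True
    then have "v 4 = 0" using n nz by auto
    then have nzv: "x \<noteq> 0 \<or> y \<noteq> 0 \<or> z \<noteq> 0 \<or> w \<noteq> 0"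
    proof -
      obtain k where k: "k < 8" "v k \<noteq> 0" using v(1) by auto
      then have "k = 0 \<or> k = 1 \<or> k = 2 \<or> k = 3 \<or> k = 4 \<or> k = 5 \<or> k = 6 \<or> k = 7" by auto
      then show ?thesis using k(2) v(2,3,4) \<open>v 4 = 0\<close> nz by (auto simp: x_y_z_w_def)
    qed
    \<comment> \<open>The form <<f, e]] is isotropic: either [1, e] is isotropic already, or
      \<open>f\<close> is a quotient of two nonzero norms.\<close>
    have f1: "pfister1_class (g * f) e = pfister1_class g e" if g: "g \<noteq> 0" for g
    proof (cases "nrm e z w = 0")
      case *: True
      then have "nrm e x y = 0" using True by simp
      then show ?thesis using * nzv pfister1_class_isotropic by metis
    next
      case False
      have eq: "nrm e x y = f * nrm e z w" using True add_eq_0_iff_eq by blast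
      then have "nrm e x y \<noteq> 0" using False nz by simp
      then have "pfister1_class g e = pfister1_class (g * f * nrm e z w) e"
        using pfister1_class_nrm[OF g] eq by (metis mult.assoc)
      then show ?thesis using pfister1_class_nrm[OF _ False] g nz by simp
    qed
    have "pfister2_class f e = 0" using f1[of 1] by (simp add: pfister2_class_def pfister1_class_self)
    moreover have "pfister1_class (1 / m * l * f) e = pfister1_class (1 / m * l) e" using f1[of "1 / m * l"] nz by simp
    then have "pfister2_class f2 d = 0" using scale[of "1 / m"] nz by (simp add: pfister2_class_def pfister1_class_self)
    ultimately show ?thesis by simp
  qed
qed

text \<open>This makes \<pi> well defined. Up to squares, f1 <<f1 f2, e]] is the sum of <<f1, e]]
  and <<f2, e]]; so <<f1 f2, e]] and <<g1 g2, d]] are similar, hence of equal class, and \<pi> is a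
  sum of three such classes.\<close>

lemma pfister3_class_cong:
  assumes nz: "f1 \<noteq> 0" "f2 \<noteq> 0" "g1 \<noteq> 0" "g2 \<noteq> (0::'a)"
    and eq: "pfister2_class f1 e = pfister2_class g1 d" "pfister2_class f2 e = pfister2_class g2 d"
  shows "pfister3_class f1 f2 e = pfister3_class g1 g2 d"
proof -
  have *: "pfister1_class f e + pfister1_class (f * (f * f')) e = pfister2_class f e + pfister2_class f' e" if "f \<noteq> 0" for f f' e :: 'a
    using pfister1_class_square[OF that, of f' e]
    by (simp add: pfister2_class_def add_ac pfister1_class_self power2_eq_square mult_ac)
  have "pfister1_class f1 e + pfister1_class (f1 * (f1 * f2)) e = pfister1_class g1 d + pfister1_class (g1 * (g1 * g2)) d"
    using * nz eq by simp
  then have "pfister2_class (f1 * f2) e = pfister2_class (g1 * g2) d" using pfister2_class_similar nz by simp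
  then show ?thesis using eq by (simp add: pfister3_class_eq)
qed


text \<open>Symmetry of the symbol ((t, g)): the two sides differ only in the planes [g, t] and
  [t, g].\<close>

lemma pfister2_class_inseparable_slot: "(t::'a) \<noteq> 0 \<Longrightarrow> g \<noteq> 0 \<Longrightarrow> pfister2_class g (t * g) = pfister2_class t (t * g)"
  by (simp add: pfister2_class_def pfister1_class_def binary_class_commute[of g t])

text \<open>Additivity of ((t, -)): by symmetry all three algebras have the slot \<open>t\<close>,
  over which separable entries add.\<close>

lemma pfister2_class_add_inseparable_slot:
  assumes "(t::'a) \<noteq> 0" "g \<noteq> 0" "h \<noteq> 0" "g + h \<noteq> 0"
  shows "pfister2_class (g + h) (t * (g + h)) = pfister2_class g (t * g) + pfister2_class h (t * h)"
  using pfister2_class_inseparable_slot[OF assms(1,2)] pfister2_class_inseparable_slot[OF assms(1,3)]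
    pfister2_class_inseparable_slot[OF assms(1,4)] by (simp add: pfister2_class_add distrib_left)

lemma pfister2_class_artin_schreier: "a \<noteq> 0 \<Longrightarrow> pfister2_class (a::'a) (c\<^sup>2) = pfister2_class a c"
proof -
  assume a: "a \<noteq> 0"
  have "binary_class 1 (c\<^sup>2) = binary_class 1 c" using binary_class_artin_schreier[of 1 c] by simp
  moreover have "c\<^sup>2 / a = a * (c / a)\<^sup>2" using a by (simp add: field_simps power2_eq_square)
  then have "binary_class a (c\<^sup>2 / a) = binary_class a (c / a)" using binary_class_artin_schreier by metis
  ultimately show ?thesis by (simp add: pfister2_class_def pfister1_class_def)
qed

text \<open>With s = c^2 / a, the algebra ((s, b)) also has the slot \<open>a\<close>: as s is
  \<open>a\<close> times the square of c / a, moving this square across turns [a, s b / a] into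
  [s, b].\<close>

lemma pfister2_class_change_slot:
  assumes "a \<noteq> 0" "(b::'a) \<noteq> 0"
  shows "pfister2_class a (c\<^sup>2 / a * b) = pfister2_class b (c\<^sup>2 / a * b)"
proof -
  have "binary_class a (c\<^sup>2 / a * b / a) = binary_class a (b * (c / a)\<^sup>2)"
    using assms by (simp add: field_simps power2_eq_square)
  also have "\<dots> = binary_class (a * (c / a)\<^sup>2) b" by (rule binary_class_square[symmetric])
  also have "a * (c / a)\<^sup>2 = c\<^sup>2 / a" using assms by (simp add: field_simps power2_eq_square)
  also have "binary_class (c\<^sup>2 / a) b = binary_class b (c\<^sup>2 / a)" by (rule binary_class_commute)
  finally show ?thesis using assms by (simp add: pfister2_class_def pfister1_class_def)
qed

text \<open>The hypothesis is triple linkage in terms of classes of norm forms: a common separable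
  entry \<open>e\<close>, or a common inseparable slot \<beta>.\<close>

lemma pfister3_class_zero:
  assumes linked: "\<And>\<alpha>1 \<beta>1 \<alpha>2 \<beta>2 \<alpha>3 \<beta>3 :: 'a. \<beta>1 \<noteq> 0 \<Longrightarrow> \<beta>2 \<noteq> 0 \<Longrightarrow> \<beta>3 \<noteq> 0 \<Longrightarrow>
    (\<exists>e f1 f2 f3. f1 \<noteq> 0 \<and> f2 \<noteq> 0 \<and> f3 \<noteq> 0 \<and>
       pfister2_class \<beta>1 \<alpha>1 = pfister2_class f1 e \<and> pfister2_class \<beta>2 \<alpha>2 = pfister2_class f2 e \<and> pfister2_class \<beta>3 \<alpha>3 = pfister2_class f3 e) \<or>
    (\<exists>\<beta> \<gamma>1 \<gamma>2 \<gamma>3. \<beta> \<noteq> 0 \<and>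
       pfister2_class \<beta>1 \<alpha>1 = pfister2_class \<beta> \<gamma>1 \<and> pfister2_class \<beta>2 \<alpha>2 = pfister2_class \<beta> \<gamma>2 \<and> pfister2_class \<beta>3 \<alpha>3 = pfister2_class \<beta> \<gamma>3)"
    and a: "a \<noteq> 0" and b: "b \<noteq> (0::'a)"
  shows "pfister3_class a b c = 0"
proof (cases "c = 0 \<or> a + b = 0")
  \<comment> \<open>These cases are set apart because \<open>t\<close>, \<open>s\<close> and the
    slot \<open>a + b\<close> must be nonzero later. For \<open>a = b\<close> the product
    \<open>a * b\<close> is a square, and the four planes cancel in pairs.\<close>
  case True
  then show ?thesis
  proof
    assume "c = 0"
    then show ?thesis by (simp add: pfister3_class_def pfister1_class_def binary_class_zero_right)
  next
    assume "a + b = 0"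
    then have "a = b" using add_eq_0_iff_eq by simp
    then show ?thesis using pfister1_class_square[OF a, of 1 c]
      by (simp add: pfister3_class_def power2_eq_square pfister1_class_self)
  qed
next
  case False
  then have c: "c \<noteq> 0" and ab: "a + b \<noteq> 0" by auto
  define t s where "t = c / b" "s = c\<^sup>2 / a"
  have t: "t \<noteq> 0" "t * b = c" and s: "s \<noteq> 0" "s * a = c\<^sup>2" using a b c by (auto simp: t_s_def)
  have X1: "pfister2_class b c = pfister2_class t (t * b)" using pfister2_class_inseparable_slot[OF t(1) b] t(2) by simp
  have Y1: "pfister2_class a (s * b) = pfister2_class b (s * b)" using pfister2_class_change_slot[OF a b] by (simp add: t_s_def)
  have Y2: "pfister2_class a (s * a) = pfister2_class a c" using pfister2_class_artin_schreier[OF a] s(2) by simp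
  \<comment> \<open>Both summands of ((s, a + b)) = ((s, a)) + ((s, b)) have the slot
    \<open>a\<close>, hence so does the sum.\<close>
  have Y: "pfister2_class (a + b) (s * (a + b)) = pfister2_class a (s * (a + b))"
    using pfister2_class_add_inseparable_slot[OF s(1) a b ab] Y1 by (simp add: pfister2_class_add distrib_left)
  \<comment> \<open>The first triple is ((t, b)), ((s, b)), ((s, a)), the last two written with the
    slot \<open>a\<close>.\<close>
  show ?thesis
    using linked[of b a a c "s * b" c, OF b a a]
  proof (elim disjE exE conjE)
    fix \<beta> \<gamma>1 \<gamma>2 \<gamma>3 assume "\<beta> \<noteq> 0" "pfister2_class b c = pfister2_class \<beta> \<gamma>1" "pfister2_class a c = pfister2_class \<beta> \<gamma>3"
    then show ?thesis using common_slots_zero[OF a b, of \<beta> \<gamma>3 c \<gamma>1] by simp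
  next
    fix e f1 f2 f3
    assume f: "f1 \<noteq> 0" "f2 \<noteq> 0" "f3 \<noteq> 0"
      and eq: "pfister2_class b c = pfister2_class f1 e" "pfister2_class a (s * b) = pfister2_class f2 e" "pfister2_class a c = pfister2_class f3 e"
    \<comment> \<open>The algebras ((t, b)) and ((s, b)) share the slot \<open>b\<close> besides
      \<open>e\<close>, so every multiple of <<f1, f2, e]] vanishes.\<close>
    have 12: "pfister1_class g e + (pfister1_class (g * f1) e + (pfister1_class (g * f2) e + pfister1_class (g * f1 * f2) e)) = 0" if "g \<noteq> 0" for g
      using common_slots[OF f(1,2) b that eq(1)] eq(2) Y1 by simp
    have "pfister2_class a (s * b + s * a) = pfister2_class (f2 * f3) e"
      using common_slots_sum[OF f(2,3) a] eq Y2 by simp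
    then have Y23: "pfister2_class a (s * (a + b)) = pfister2_class (f2 * f3) e" by (simp add: distrib_left add.commute)
    \<comment> \<open>Replacing ((s, a)) by ((s, a + b)), which has the slot \<open>f2 * f3\<close>
      over \<open>e\<close>, changes \<pi> by f3 <<f1, f2, e]]; this is zero by
      \<open>12\<close>.\<close>
    have "pfister3_class a b c = pfister3_class f3 f1 e" using pfister3_class_cong[OF a b f(3,1)] eq by simp
    also have "\<dots> = pfister3_class f1 (f2 * f3) e + (pfister1_class f3 e + (pfister1_class (f3 * f1) e + (pfister1_class (f3 * f2) e + pfister1_class (f3 * f1 * f2) e)))"
      by (simp add: pfister3_class_def add_ac mult_ac pfister1_class_self)
    also have "\<dots> = pfister3_class f1 (f2 * f3) e" using 12[OF f(3)] by simp
    finally have pi: "pfister3_class a b c = pfister3_class f1 (f2 * f3) e" .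
    have f23: "f2 * f3 \<noteq> 0" using f by simp
    have X12: "pfister2_class (a + b) (t * (a + b)) = pfister2_class t (t * (a + b))"
      and X2: "pfister2_class a (t * a) = pfister2_class t (t * a)"
      using pfister2_class_inseparable_slot t(1) a ab by auto
    \<comment> \<open>The second triple is ((t, a + b)), ((t, a)), ((s, a + b)); its first two
      members add up to ((t, b)).\<close>
    show ?thesis
      using linked[of "a + b" a "a + b" "t * (a + b)" "t * a" "s * (a + b)", OF ab a ab]
    proof (elim disjE exE conjE)
      fix \<beta> \<gamma>1 \<gamma>2 \<gamma>3
      assume \<beta>: "\<beta> \<noteq> 0" and eq': "pfister2_class (a + b) (t * (a + b)) = pfister2_class \<beta> \<gamma>1"
        "pfister2_class a (t * a) = pfister2_class \<beta> \<gamma>2" "pfister2_class (a + b) (s * (a + b)) = pfister2_class \<beta> \<gamma>3"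
      \<comment> \<open>Here ((t, b)) and ((s, a + b)) share the slot \<beta> in addition to the
        entry \<open>e\<close>.\<close>
      have "pfister2_class \<beta> (\<gamma>1 + \<gamma>2) = pfister2_class t (t * (a + b) + t * a)"
        using eq' X12 X2 by (simp add: pfister2_class_add)
      also have "t * (a + b) + t * a = t * b" by (simp add: distrib_left add_ac char2_simps)
      finally have "pfister2_class \<beta> (\<gamma>1 + \<gamma>2) = pfister2_class f1 e" using X1 eq(1) by simp
      moreover have "pfister2_class \<beta> \<gamma>3 = pfister2_class (f2 * f3) e" using eq'(3) Y Y23 by simp
      ultimately show ?thesis using common_slots_zero[OF f(1) f23 \<beta>] pi by simp
    next
      fix d g1 g2 g3
      assume g: "g1 \<noteq> 0" "g2 \<noteq> 0" "g3 \<noteq> 0"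
        and eq': "pfister2_class (a + b) (t * (a + b)) = pfister2_class g1 d"
          "pfister2_class a (t * a) = pfister2_class g2 d" "pfister2_class (a + b) (s * (a + b)) = pfister2_class g3 d"
      have g12: "g1 * g2 \<noteq> 0" using g by simp
      have "pfister2_class t (t * (a + b) + t * a) = pfister2_class (g1 * g2) d"
        using common_slots_sum[OF g(1,2) t(1)] eq' X12 X2 by simp
      also have "t * (a + b) + t * a = t * b" by (simp add: distrib_left add_ac char2_simps)
      finally have "pfister2_class f1 e = pfister2_class (g1 * g2) d" using X1 eq(1) by simp
      moreover have "pfister2_class (f2 * f3) e = pfister2_class g3 d" using eq'(3) Y Y23 by simp
      ultimately have "pfister3_class a b c = pfister3_class (g1 * g2) g3 d"
        using pi pfister3_class_cong[OF f(1) f23 g12 g(3)] by simp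
      \<comment> \<open>The class splits as <<g1, g3, d]] + g1 <<g2, g3, d]]. The first term
        vanishes by the common slot \<open>a + b\<close>, the second by the common slot
        \<open>a\<close>, which ((s, a + b)) has by \<open>Y\<close>.\<close>
      also have "\<dots> = pfister3_class g1 g3 d +
          (pfister1_class g1 d + (pfister1_class (g1 * g2) d + (pfister1_class (g1 * g3) d + pfister1_class (g1 * g2 * g3) d)))"
        by (simp add: pfister3_class_def add_ac mult_ac pfister1_class_self)
      also have "\<dots> = 0"
        using common_slots_zero[OF g(1,3) ab eq'(1,3)] eq' Y
          common_slots[OF g(2,3) a g(1) eq'(2), of "s * (a + b)"] by simp
      finally show ?thesis .
    qed
  qed
qed

end

section \<open>Quaternion algebras and their norm forms\<close>

lemma vec4_eq_iff [simp]: "vec4 a b c d = vec4 a' b' c' d' \<longleftrightarrow> a = a' \<and> b = b' \<and> c = c' \<and> d = d'"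
  by (metis vec4_index(1-4))

lemma vec4_arith [simp]:
  "vec4 a b c d + vec4 a' b' c' d' = vec4 (a + a') (b + b') (c + c') (d + (d'::'a::field))"
  "k \<cdot>\<^sub>v vec4 a b c d = vec4 (k * a) (k * b) (k * c) (k * d)"
  "0\<^sub>v 4 = vec4 (0::'a) 0 0 0"
  by (auto simp: vec4_def intro!: eq_vecI)

lemma carrier_vec_4E:
  assumes "v \<in> carrier_vec 4"
  obtains a b c d where "v = vec4 a b c d"
  using vec4_cases[OF assms] by blast

text \<open>Coordinates with respect to the basis \<open>1, x, y, xy\<close>. With \<open>K = F[x]\<close> the product is
  \<open>(k\<^sub>1 + k\<^sub>2 y) (l\<^sub>1 + l\<^sub>2 y) = k\<^sub>1 l\<^sub>1 + \<beta> k\<^sub>2 l\<^sub>2' + (k\<^sub>1 l\<^sub>2 + k\<^sub>2 l\<^sub>1') y\<close>, the prime being the conjugation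
  \<open>x \<mapsto> x + 1\<close> of \<open>K\<close>.\<close>

definition quat_mult :: "'a::field \<Rightarrow> 'a \<Rightarrow> 'a vec \<Rightarrow> 'a vec \<Rightarrow> 'a vec" where
  "quat_mult \<alpha> \<beta> u v = vec4
     (u $ 0 * v $ 0 + \<alpha> * (u $ 1 * v $ 1) + \<beta> * (u $ 2 * v $ 2 + u $ 2 * v $ 3 + \<alpha> * (u $ 3 * v $ 3)))
     (u $ 0 * v $ 1 + u $ 1 * v $ 0 + u $ 1 * v $ 1 + \<beta> * (u $ 2 * v $ 3 + u $ 3 * v $ 2))
     (u $ 0 * v $ 2 + \<alpha> * (u $ 1 * v $ 3) + u $ 2 * v $ 0 + u $ 2 * v $ 1 + \<alpha> * (u $ 3 * v $ 1))
     (u $ 0 * v $ 3 + u $ 1 * v $ 2 + u $ 1 * v $ 3 + u $ 2 * v $ 1 + u $ 3 * v $ 0)"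

lemma quat_mult_vec4:
  "quat_mult \<alpha> \<beta> (vec4 a0 a1 a2 a3) (vec4 b0 b1 b2 b3) = vec4
     (a0 * b0 + \<alpha> * (a1 * b1) + \<beta> * (a2 * b2 + a2 * b3 + \<alpha> * (a3 * b3)))
     (a0 * b1 + a1 * b0 + a1 * b1 + \<beta> * (a2 * b3 + a3 * b2))
     (a0 * b2 + \<alpha> * (a1 * b3) + a2 * b0 + a2 * b1 + \<alpha> * (a3 * b1))
     (a0 * b3 + a1 * b2 + a1 * b3 + a2 * b1 + a3 * b0)"
  by (simp add: quat_mult_def)

text \<open>A concrete model of [\<alpha>, \<beta>) on coordinate vectors, which is the type of
  algebras to which the linkage hypothesis applies.\<close>

definition quat_alg :: "'a::field \<Rightarrow> 'a \<Rightarrow> ('a, 'a vec) module" where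
  "quat_alg \<alpha> \<beta> = \<lparr>carrier = carrier_vec 4, mult = quat_mult \<alpha> \<beta>, one = vec4 1 0 0 0,
     zero = 0\<^sub>v 4, add = (+), smult = (\<cdot>\<^sub>v)\<rparr>"

lemma quat_alg_simps [simp]:
  "carrier (quat_alg \<alpha> \<beta>) = carrier_vec 4" "mult (quat_alg \<alpha> \<beta>) = quat_mult \<alpha> \<beta>"
  "one (quat_alg \<alpha> \<beta>) = vec4 1 0 0 0" "zero (quat_alg \<alpha> \<beta>) = 0\<^sub>v 4"
  "add (quat_alg \<alpha> \<beta>) = (+)" "smult (quat_alg \<alpha> \<beta>) = (\<cdot>\<^sub>v)"
  by (simp_all add: quat_alg_def)

text \<open>The reduced norm of (a + b x) + (c + d x) y.\<close>

definition quat_norm :: "'a::field \<Rightarrow> 'a \<Rightarrow> 'a \<Rightarrow> 'a \<Rightarrow> 'a \<Rightarrow> 'a \<Rightarrow> 'a" where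
  "quat_norm \<alpha> \<beta> a b c d = a\<^sup>2 + a * b + \<alpha> * b\<^sup>2 + \<beta> * (c\<^sup>2 + c * d + \<alpha> * d\<^sup>2)"

lemma qdim_quad_pfister1 [simp]: "qdim (quad_pfister1 c) = 2"
  by (simp add: quad_pfister1_def)

lemma qdim_scale_form [simp]: "qdim (scale_form c q) = qdim q"
  by (simp add: scale_form_def)

lemma quad_pfister2_eq:
  "quad_pfister2 b c = scale_form 1 (quad_pfister1 c) \<bottom>\<^sub>q (scale_form b (quad_pfister1 c) \<bottom>\<^sub>q zero_form)"
  by (simp add: quad_pfister2_def diag_tensor_def bilinear_pfister1_def)

lemma qdim_quad_pfister2 [simp]: "qdim (quad_pfister2 b c) = 4"
  by (simp add: quad_pfister2_eq)

lemma qval_quad_pfister2: "qval (quad_pfister2 \<beta> \<alpha>) (vec4 a b c d) = quat_norm \<alpha> \<beta> a b c d"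
proof -
  have "vec_first (vec2 c d) 2 = vec2 c d"
    by (auto simp: vec_first_def vec2_def intro!: eq_vecI)
  then show ?thesis
    by (simp add: quad_pfister2_eq qval_orth_sum_2 qval_vec2 qval_orth_sum[of _ zero_form] quat_norm_def)
      (simp add: zero_form_def)
qed

lemma linear_fun_inverse:
  assumes f: "linear_fun n n f" and g: "\<And>v. v \<in> carrier_vec n \<Longrightarrow> g v \<in> carrier_vec n"
    and fg: "\<And>v. v \<in> carrier_vec n \<Longrightarrow> f (g v) = v" and gf: "\<And>v. v \<in> carrier_vec n \<Longrightarrow> g (f v) = v"
  shows "linear_fun n n g"
  unfolding linear_fun_def
proof (intro conjI ballI allI)
  fix v w :: "'a vec" assume v: "v \<in> carrier_vec n" and w: "w \<in> carrier_vec n"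
  have "v + w = f (g v + g w)" using f g[OF v] g[OF w] fg v w unfolding linear_fun_def by simp
  then show "g (v + w) = g v + g w" using gf g[OF v] g[OF w] by simp
next
  fix c and v :: "'a vec" assume v: "v \<in> carrier_vec n"
  have "c \<cdot>\<^sub>v v = f (c \<cdot>\<^sub>v g v)" using f g[OF v] fg v unfolding linear_fun_def by simp
  then show "g (c \<cdot>\<^sub>v v) = c \<cdot>\<^sub>v g v" using gf g[OF v] by simp
qed (rule g)

section \<open>The coordinate algebra, and its norm form for any presentation\<close>

context char_two
begin

lemma quat_mult_assoc:
  assumes "u \<in> carrier_vec 4" "v \<in> carrier_vec 4" "w \<in> carrier_vec 4"
  shows "quat_mult \<alpha> \<beta> (quat_mult \<alpha> \<beta> u v) w = quat_mult (\<alpha>::'a) \<beta> u (quat_mult \<alpha> \<beta> v w)"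
  using assms
  by (elim carrier_vec_4E) (simp add: quat_mult_vec4 algebra_simps char2_simps)

lemma ring_quat_alg: "ring (quat_alg (\<alpha>::'a) \<beta>)"
proof (rule ringI)
  show "abelian_group (quat_alg \<alpha> \<beta>)"
  proof (rule abelian_groupI)
    fix x assume "x \<in> carrier (quat_alg \<alpha> \<beta>)"
    then show "\<exists>y\<in>carrier (quat_alg \<alpha> \<beta>). y \<oplus>\<^bsub>quat_alg \<alpha> \<beta>\<^esub> x = \<zero>\<^bsub>quat_alg \<alpha> \<beta>\<^esub>"
      by (intro bexI[of _ x]) (auto elim!: carrier_vec_4E simp: char2_simps)
  qed (auto elim!: carrier_vec_4E simp: add_ac)
  show "monoid (quat_alg \<alpha> \<beta>)"
    by (rule monoidI) (use quat_mult_assoc in \<open>auto elim!: carrier_vec_4E simp: quat_mult_vec4\<close>)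
qed (auto elim!: carrier_vec_4E simp: quat_mult_vec4 algebra_simps)

lemma assoc_algebra_quat_alg: "assoc_algebra (quat_alg (\<alpha>::'a) \<beta>)"
  unfolding assoc_algebra_def
proof (intro conjI allI ballI)
  show "module class_ring (quat_alg \<alpha> \<beta>)"
    by (rule moduleI[OF class_cring.is_cring ring.is_abelian_group[OF ring_quat_alg]])
      (auto elim!: carrier_vec_4E simp: class_ring_simps algebra_simps)
qed (auto intro: ring_quat_alg elim!: carrier_vec_4E simp: quat_mult_vec4 algebra_simps)

lemma quaternion_symbol_quat_alg:
  assumes \<beta>: "\<beta> \<noteq> 0"
  shows "quaternion_symbol (quat_alg (\<alpha>::'a) \<beta>) \<alpha> \<beta>"
proof -
  let ?A = "quat_alg \<alpha> \<beta>"
  interpret A: ring ?A by (rule ring_quat_alg)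
  define x y where "x = vec4 0 1 0 (0::'a)" "y = vec4 0 0 1 (0::'a)"
  \<comment> \<open>The inverse of y is y / \<beta>, as y^2 = \<beta>.\<close>
  define y' where "y' = vec4 0 0 (1 / \<beta>) 0"
  have y: "y \<in> Units ?A"
    unfolding Units_def using \<beta>
    by (auto simp: x_y_def y'_def quat_mult_vec4 intro!: bexI[of _ y'])
  have x1: "x \<oplus>\<^bsub>?A\<^esub> \<one>\<^bsub>?A\<^esub> \<in> carrier ?A" by (simp add: x_y_def)
  have "y \<otimes>\<^bsub>?A\<^esub> x = (x \<oplus>\<^bsub>?A\<^esub> \<one>\<^bsub>?A\<^esub>) \<otimes>\<^bsub>?A\<^esub> y" by (simp add: x_y_def quat_mult_vec4)
  moreover have "(x \<oplus>\<^bsub>?A\<^esub> \<one>\<^bsub>?A\<^esub>) \<otimes>\<^bsub>?A\<^esub> y \<otimes>\<^bsub>?A\<^esub> inv\<^bsub>?A\<^esub> y = x \<oplus>\<^bsub>?A\<^esub> \<one>\<^bsub>?A\<^esub>"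
    by (simp only: A.m_assoc[OF x1 A.Units_closed[OF y] A.Units_inv_closed[OF y]]
        A.Units_r_inv[OF y] A.r_one[OF x1])
  ultimately have c: "y \<otimes>\<^bsub>?A\<^esub> x \<otimes>\<^bsub>?A\<^esub> inv\<^bsub>?A\<^esub> y = x \<oplus>\<^bsub>?A\<^esub> \<one>\<^bsub>?A\<^esub>" by simp
  show ?thesis unfolding quaternion_symbol_def
  proof (intro conjI, rule assoc_algebra_quat_alg, rule \<beta>, rule bexI[of _ x], rule bexI[of _ y],
      intro conjI ballI y c)
    fix z assume "z \<in> carrier ?A"
    then have "z \<in> carrier_vec 4" by simp
    then obtain a0 a1 a2 a3 where "z = vec4 a0 a1 a2 a3" by (rule carrier_vec_4E)
    then show "\<exists>!(c0, c1, c2, c3). z = c0 \<odot>\<^bsub>?A\<^esub> \<one>\<^bsub>?A\<^esub> \<oplus>\<^bsub>?A\<^esub> c1 \<odot>\<^bsub>?A\<^esub> x \<oplus>\<^bsub>?A\<^esub>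
        c2 \<odot>\<^bsub>?A\<^esub> y \<oplus>\<^bsub>?A\<^esub> c3 \<odot>\<^bsub>?A\<^esub> (x \<otimes>\<^bsub>?A\<^esub> y)"
      by (intro ex1I[of _ "(a0, a1, a2, a3)"]) (auto simp: x_y_def quat_mult_vec4)
  qed (use y c in \<open>simp_all add: x_y_def quat_mult_vec4 char2_simps\<close>)
qed

lemma quat_norm_mult:
  "quat_mult \<alpha> \<beta> (vec4 a0 a1 a2 a3) (vec4 b0 b1 b2 b3) = vec4 r0 r1 r2 r3 \<Longrightarrow>
    quat_norm \<alpha> \<beta> r0 r1 r2 r3 = quat_norm \<alpha> \<beta> a0 a1 a2 a3 * quat_norm (\<alpha>::'a) \<beta> b0 b1 b2 b3"
  unfolding quat_mult_vec4 vec4_eq_iff quat_norm_def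
  by (elim conjE, hypsubst) (simp add: power2_eq_square algebra_simps char2_simps)

text \<open>The norm is expanded in the basis 1, x, y, xy of another presentation. The relations
  give the norms 1, \<alpha>', \<beta>', \<alpha>' \<beta>', and among the polar products only those
  of 1 with x and of y with xy survive, with values 1 and \<beta>'.\<close>

lemma quat_norm_combination:
  assumes xx: "quat_mult \<alpha> \<beta> x x + x = vec4 \<alpha>' 0 0 0" and yy: "quat_mult \<alpha> \<beta> y y = vec4 \<beta>' 0 0 0"
    and yx: "quat_mult \<alpha> \<beta> y x = quat_mult \<alpha> \<beta> (x + vec4 1 0 0 0) y" and \<beta>': "\<beta>' \<noteq> (0::'a)"
    and v: "x \<in> carrier_vec 4" "y \<in> carrier_vec 4"
    and z: "vec4 d0 d1 d2 d3 = c0 \<cdot>\<^sub>v vec4 1 0 0 0 + c1 \<cdot>\<^sub>v x + c2 \<cdot>\<^sub>v y + c3 \<cdot>\<^sub>v quat_mult \<alpha> \<beta> x y"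
  shows "quat_norm \<alpha> \<beta> d0 d1 d2 d3 = quat_norm \<alpha>' \<beta>' c0 c1 c2 c3"
proof -
  obtain p0 p1 p2 p3 q0 q1 q2 q3 where p: "x = vec4 p0 p1 p2 p3" and q: "y = vec4 q0 q1 q2 q3"
    using v by (metis vec4_cases)
  \<comment> \<open>\<open>B\<close> is the polar form of the norm. The coordinate of index 1, such
    as \<open>p1\<close> or \<open>q1\<close>, is the reduced trace.\<close>
  define B where "B u0 u1 u2 u3 w0 w1 w2 w3 = u0 * w1 + u1 * w0 + \<beta> * (u2 * w3 + u3 * w2)"
    for u0 u1 u2 u3 w0 w1 w2 w3 :: 'a
  let ?N = "quat_norm \<alpha> \<beta>"
  have N_add: "?N (u0 + w0) (u1 + w1) (u2 + w2) (u3 + w3) = ?N u0 u1 u2 u3 + ?N w0 w1 w2 w3 + B u0 u1 u2 u3 w0 w1 w2 w3"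
    for u0 u1 u2 u3 w0 w1 w2 w3
    by (simp add: quat_norm_def B_def power2_eq_square algebra_simps char2_simps)
  have q1: "q1 = 0" using yy by (simp add: q quat_mult_vec4 algebra_simps char2_simps)
  have Nq: "?N q0 q1 q2 q3 = \<beta>'"
    using yy by (simp add: q quat_mult_vec4 quat_norm_def q1 power2_eq_square algebra_simps)
  have anti: "B p0 p1 p2 p3 q0 q1 q2 q3 + p1 * q0 = q0" "p1 * q2 = q2" "p1 * q3 = q3"
    using yx q1 by (simp_all add: p q quat_mult_vec4 B_def algebra_simps char2_simps add_eq_0_iff_eq)
  have "p1 * p1 = p1" using xx by (simp add: p quat_mult_vec4 algebra_simps char2_simps add_eq_0_iff_eq)
  then have "p1 = 0 \<or> p1 = 1" by simp
  \<comment> \<open>Trace 0 for x would force y = 0 by the commutation relation, against \<beta>'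
    being nonzero.\<close>
  then have p1: "p1 = 1"
  proof
    assume "p1 = 0"
    then have "q2 = 0" "q3 = 0" using anti by auto
    moreover have "q0 = 0" using anti(1) \<open>p1 = 0\<close> q1 calculation by (simp add: B_def)
    ultimately show ?thesis using Nq q1 \<beta>' by (simp add: quat_norm_def)
  qed
  have Bpq: "B p0 p1 p2 p3 q0 q1 q2 q3 = 0" using anti(1) p1 by simp
  have Np: "?N p0 p1 p2 p3 = \<alpha>'"
    using xx by (simp add: p p1 quat_mult_vec4 quat_norm_def power2_eq_square algebra_simps char2_simps)
  obtain r0 r1 r2 r3 where r: "quat_mult \<alpha> \<beta> x y = vec4 r0 r1 r2 r3"
    unfolding p q quat_mult_vec4 by blast
  have Nr: "?N r0 r1 r2 r3 = \<alpha>' * \<beta>'" using quat_norm_mult r Np Nq unfolding p q by metis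
  have r1: "r1 = 0" and Bpr: "B p0 p1 p2 p3 r0 r1 r2 r3 = 0" and Bqr: "B q0 q1 q2 q3 r0 r1 r2 r3 = \<beta>'"
  proof -
    show "r1 = 0" using r Bpq by (simp add: p q quat_mult_vec4 B_def q1 p1)
    \<comment> \<open>The polar product of x with xy is the norm of x times the trace of y; likewise
      that of y with xy is the norm of y times the trace of x.\<close>
    have "B p0 p1 p2 p3 r0 r1 r2 r3 = ?N p0 p1 p2 p3 * q1"
      using r unfolding p q quat_mult_vec4 vec4_eq_iff B_def quat_norm_def
      by (elim conjE, hypsubst) (simp add: power2_eq_square algebra_simps char2_simps)
    then show "B p0 p1 p2 p3 r0 r1 r2 r3 = 0" using q1 by simp
    have "B q0 q1 q2 q3 r0 r1 r2 r3 = ?N q0 q1 q2 q3 * p1"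
      using r unfolding p q quat_mult_vec4 vec4_eq_iff B_def quat_norm_def
      by (elim conjE, hypsubst) (simp add: power2_eq_square algebra_simps char2_simps)
    then show "B q0 q1 q2 q3 r0 r1 r2 r3 = \<beta>'" using p1 Nq by simp
  qed
  have N_smult: "?N (c * u0) (c * u1) (c * u2) (c * u3) = c\<^sup>2 * ?N u0 u1 u2 u3" for c u0 u1 u2 u3
    by (simp add: quat_norm_def power2_eq_square algebra_simps)
  have d: "d0 = (c0 + c1 * p0 + c2 * q0) + c3 * r0" "d1 = (0 + c1 * p1 + c2 * q1) + c3 * r1"
    "d2 = (0 + c1 * p2 + c2 * q2) + c3 * r2" "d3 = (0 + c1 * p3 + c2 * q3) + c3 * r3"
    using z r unfolding p q by simp_all
  have "?N d0 d1 d2 d3 = ?N (c0 + c1 * p0 + c2 * q0) (0 + c1 * p1 + c2 * q1) (0 + c1 * p2 + c2 * q2) (0 + c1 * p3 + c2 * q3)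
      + c3\<^sup>2 * (\<alpha>' * \<beta>') + (c0 * (c3 * r1) + c1 * c3 * B p0 p1 p2 p3 r0 r1 r2 r3 + c2 * c3 * B q0 q1 q2 q3 r0 r1 r2 r3)"
    unfolding d N_add N_smult Nr by (simp add: B_def algebra_simps)
  also have "\<dots> = ?N (c0 + c1 * p0 + c2 * q0) (0 + c1 * p1 + c2 * q1) (0 + c1 * p2 + c2 * q2) (0 + c1 * p3 + c2 * q3)
      + c3\<^sup>2 * (\<alpha>' * \<beta>') + c2 * c3 * \<beta>'"
    using r1 Bpr Bqr by simp
  also have "?N (c0 + c1 * p0 + c2 * q0) (0 + c1 * p1 + c2 * q1) (0 + c1 * p2 + c2 * q2) (0 + c1 * p3 + c2 * q3)
      = ?N (c0 + c1 * p0) (0 + c1 * p1) (0 + c1 * p2) (0 + c1 * p3) + c2\<^sup>2 * \<beta>' +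
        (c0 * (c2 * q1) + c1 * c2 * B p0 p1 p2 p3 q0 q1 q2 q3)"
    unfolding N_add N_smult Nq by (simp add: B_def algebra_simps)
  also have "\<dots> = ?N (c0 + c1 * p0) (0 + c1 * p1) (0 + c1 * p2) (0 + c1 * p3) + c2\<^sup>2 * \<beta>'"
    using q1 Bpq by simp
  also have "?N (c0 + c1 * p0) (0 + c1 * p1) (0 + c1 * p2) (0 + c1 * p3) = c0\<^sup>2 + c1\<^sup>2 * \<alpha>' + c0 * c1"
    unfolding N_add N_smult Np by (simp add: B_def p1 quat_norm_def)
  finally show ?thesis by (simp add: quat_norm_def algebra_simps)
qed

text \<open>Passing to the basis of another presentation is a linear bijection that respects the
  norms. This is needed because \<open>norm_form\<close> accepts any presentation of the
  algebra.\<close>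

lemma norm_form_quat_alg:
  assumes "quaternion_symbol (quat_alg (\<alpha>::'a) \<beta>) \<alpha>' \<beta>'"
  shows "quad_pfister2 \<beta>' \<alpha>' \<cong>\<^sub>q quad_pfister2 \<beta> \<alpha>"
proof -
  let ?A = "quat_alg \<alpha> \<beta>"
  interpret A: ring ?A by (rule ring_quat_alg)
  from assms obtain x y where \<beta>': "\<beta>' \<noteq> 0" and x: "x \<in> carrier ?A" and yU: "y \<in> Units ?A"
    and xx: "x \<otimes>\<^bsub>?A\<^esub> x \<oplus>\<^bsub>?A\<^esub> x = \<alpha>' \<odot>\<^bsub>?A\<^esub> \<one>\<^bsub>?A\<^esub>"
    and yy: "y \<otimes>\<^bsub>?A\<^esub> y = \<beta>' \<odot>\<^bsub>?A\<^esub> \<one>\<^bsub>?A\<^esub>"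
    and yxy: "y \<otimes>\<^bsub>?A\<^esub> x \<otimes>\<^bsub>?A\<^esub> inv\<^bsub>?A\<^esub> y = x \<oplus>\<^bsub>?A\<^esub> \<one>\<^bsub>?A\<^esub>"
    and basis: "\<And>z. z \<in> carrier ?A \<Longrightarrow> \<exists>!(c0, c1, c2, c3).
      z = c0 \<odot>\<^bsub>?A\<^esub> \<one>\<^bsub>?A\<^esub> \<oplus>\<^bsub>?A\<^esub> c1 \<odot>\<^bsub>?A\<^esub> x \<oplus>\<^bsub>?A\<^esub> c2 \<odot>\<^bsub>?A\<^esub> y \<oplus>\<^bsub>?A\<^esub> c3 \<odot>\<^bsub>?A\<^esub> (x \<otimes>\<^bsub>?A\<^esub> y)"
    unfolding quaternion_symbol_def by (elim conjE bexE) (rule that; (assumption | drule (1) bspec, assumption))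
  have y: "y \<in> carrier ?A" using yU by (rule A.Units_closed)
  have yi: "inv\<^bsub>?A\<^esub> y \<in> carrier ?A" using yU by (rule A.Units_inv_closed)
  have "y \<otimes>\<^bsub>?A\<^esub> x \<otimes>\<^bsub>?A\<^esub> inv\<^bsub>?A\<^esub> y \<otimes>\<^bsub>?A\<^esub> y = y \<otimes>\<^bsub>?A\<^esub> x"
    by (simp only: A.m_assoc[OF A.m_closed[OF y x] yi y] A.Units_l_inv[OF yU] A.r_one[OF A.m_closed[OF y x]])
  then have yx: "y \<otimes>\<^bsub>?A\<^esub> x = (x \<oplus>\<^bsub>?A\<^esub> \<one>\<^bsub>?A\<^esub>) \<otimes>\<^bsub>?A\<^esub> y" using yxy by simp
  define f where "f v = v $ 0 \<cdot>\<^sub>v vec4 1 0 0 0 + v $ 1 \<cdot>\<^sub>v x + v $ 2 \<cdot>\<^sub>v y + v $ 3 \<cdot>\<^sub>v quat_mult \<alpha> \<beta> x y"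
    for v :: "'a vec"
  have xc: "x \<in> carrier_vec 4" and yc: "y \<in> carrier_vec 4" using x y by auto
  have xyc: "quat_mult \<alpha> \<beta> x y \<in> carrier_vec 4" by (simp add: quat_mult_def)
  have f4: "f (vec4 c0 c1 c2 c3) = c0 \<cdot>\<^sub>v vec4 1 0 0 0 + c1 \<cdot>\<^sub>v x + c2 \<cdot>\<^sub>v y + c3 \<cdot>\<^sub>v quat_mult \<alpha> \<beta> x y"
    for c0 c1 c2 c3 by (simp add: f_def)
  have fc: "f v \<in> carrier_vec 4" for v using xc yc xyc by (simp add: f_def)
  have lin: "linear_fun 4 4 f"
    unfolding linear_fun_def using xc yc xyc
    by (auto simp: f_def less_4_cases_iff algebra_simps intro!: eq_vecI)
  have ex: "\<exists>!v. v \<in> carrier_vec 4 \<and> f v = w" if w: "w \<in> carrier_vec 4" for w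
  proof -
    from basis[of w] w obtain c0 c1 c2 c3 where c: "w = f (vec4 c0 c1 c2 c3)"
      and u: "\<And>d0 d1 d2 d3. w = f (vec4 d0 d1 d2 d3) \<Longrightarrow> (d0, d1, d2, d3) = (c0, c1, c2, c3)"
      unfolding f4 by (auto simp: Ex1_def)
    show ?thesis
    proof (rule ex1I[of _ "vec4 c0 c1 c2 c3"])
      fix v assume v: "v \<in> carrier_vec 4 \<and> f v = w"
      then obtain d0 d1 d2 d3 where "v = vec4 d0 d1 d2 d3" using carrier_vec_4E by metis
      then show "v = vec4 c0 c1 c2 c3" using u v by auto
    qed (use c in auto)
  qed
  define g where "g w = (THE v. v \<in> carrier_vec 4 \<and> f v = w)" for w
  have g: "g w \<in> carrier_vec 4" "f (g w) = w" if "w \<in> carrier_vec 4" for w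
    using theI'[OF ex[OF that]] unfolding g_def by auto
  have gf: "g (f v) = v" if v: "v \<in> carrier_vec 4" for v
    using ex[OF fc[of v]] g[OF fc[of v]] v by blast
  show ?thesis
  proof (rule isometricI[of _ 4 _ f g])
    show "linear_fun 4 4 g" by (rule linear_fun_inverse[OF lin]) (use g gf in auto)
    fix v :: "'a vec" assume "v \<in> carrier_vec 4"
    then obtain c0 c1 c2 c3 where v: "v = vec4 c0 c1 c2 c3" using carrier_vec_4E by blast
    obtain d0 d1 d2 d3 where d: "f v = vec4 d0 d1 d2 d3" using carrier_vec_4E[OF fc] by metis
    have "quat_norm \<alpha> \<beta> d0 d1 d2 d3 = quat_norm \<alpha>' \<beta>' c0 c1 c2 c3"
      by (rule quat_norm_combination[of _ _ x _ y])
        (use xx yy yx \<beta>' xc yc d f4 v in auto)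
    then show "qval (quad_pfister2 \<beta> \<alpha>) (f v) = qval (quad_pfister2 \<beta>' \<alpha>') v"
      using d unfolding v by (simp add: qval_quad_pfister2)
  qed (use lin g gf in auto)
qed

section \<open>The group generated by three-fold Pfister forms\<close>

lemma quad_pfister1_eq: "quad_pfister1 c = binary_form 1 (c::'a)"
  by (simp add: quad_pfister1_def binary_form_def)

lemma scale_form_scale: "scale_form a (scale_form b q) = scale_form (a * b) q"
  by (simp add: scale_form_def mult.assoc)

lemma abs_witt_scale_quad_pfister1: "g \<noteq> 0 \<Longrightarrow> abs_witt (scale_form g (quad_pfister1 e)) = pfister1_class (g::'a) e"
  by (simp add: quad_pfister1_eq abs_witt_scale_binary pfister1_class_def)

lemma abs_witt_quad_pfister2: "b \<noteq> 0 \<Longrightarrow> abs_witt (quad_pfister2 b c) = pfister2_class (b::'a) c"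
  by (simp add: quad_pfister2_eq abs_witt_orth_sum abs_witt_zero abs_witt_scale_quad_pfister1 pfister2_class_def)

lemma abs_witt_quad_pfister3:
  assumes "a \<noteq> 0" "b \<noteq> 0"
  shows "abs_witt (quad_pfister3 a b c) = pfister3_class a b (c::'a)"
  using assms
  by (simp add: quad_pfister3_def diag_tensor_def bilinear_pfister1_def scale_orth_sum scale_form_scale
      abs_witt_orth_sum abs_witt_zero abs_witt_scale_quad_pfister1 pfister3_class_def add_ac)

text \<open>Linkage is applied to the coordinate algebras. The norm forms that it supplies may come
  from other presentations, but their Witt classes are those of the given ones.\<close>

lemma linked_pfister2_class:
  assumes linked: "\<And>Q1 Q2 Q3 :: ('a, 'a vec) module.
      quaternion_algebra Q1 \<Longrightarrow> quaternion_algebra Q2 \<Longrightarrow> quaternion_algebra Q3 \<Longrightarrow> linked [Q1, Q2, Q3]"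
    and \<beta>: "\<beta>1 \<noteq> (0::'a)" "\<beta>2 \<noteq> (0::'a)" "\<beta>3 \<noteq> (0::'a)"
  shows "(\<exists>e f1 f2 f3. f1 \<noteq> 0 \<and> f2 \<noteq> 0 \<and> f3 \<noteq> 0 \<and>
       pfister2_class \<beta>1 \<alpha>1 = pfister2_class f1 e \<and> pfister2_class \<beta>2 \<alpha>2 = pfister2_class f2 e \<and> pfister2_class \<beta>3 \<alpha>3 = pfister2_class f3 e) \<or>
    (\<exists>\<beta> \<gamma>1 \<gamma>2 \<gamma>3. \<beta> \<noteq> 0 \<and>
       pfister2_class \<beta>1 \<alpha>1 = pfister2_class \<beta> \<gamma>1 \<and> pfister2_class \<beta>2 \<alpha>2 = pfister2_class \<beta> \<gamma>2 \<and> pfister2_class \<beta>3 \<alpha>3 = pfister2_class \<beta> \<gamma>3)"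
proof -
  have "quaternion_algebra (quat_alg \<alpha> \<beta>)" if "\<beta> \<noteq> 0" for \<alpha> \<beta> :: 'a
    unfolding quaternion_algebra_def by (intro exI) (rule quaternion_symbol_quat_alg[OF that])
  from linked[OF this[OF \<beta>(1)] this[OF \<beta>(2)] this[OF \<beta>(3)]] obtain \<phi>s where all: "list_all2 norm_form
      [quat_alg \<alpha>1 \<beta>1, quat_alg \<alpha>2 \<beta>2, quat_alg \<alpha>3 \<beta>3] \<phi>s" and common: "common_pfister_factor \<phi>s"
    unfolding linked_def by blast
  from all obtain \<phi>1 \<phi>2 \<phi>3 where \<phi>s: "\<phi>s = [\<phi>1, \<phi>2, \<phi>3]" and n: "norm_form (quat_alg \<alpha>1 \<beta>1) \<phi>1"
    "norm_form (quat_alg \<alpha>2 \<beta>2) \<phi>2" "norm_form (quat_alg \<alpha>3 \<beta>3) \<phi>3"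
    by (auto simp: list_all2_Cons1)
  have norm: "abs_witt \<phi> = pfister2_class \<beta> \<alpha>" if \<phi>: "norm_form (quat_alg \<alpha> \<beta>) \<phi>" and \<beta>: "\<beta> \<noteq> 0"
    for \<alpha> \<beta> :: 'a and \<phi>
  proof -
    from \<phi> obtain \<alpha>' \<beta>' where "quaternion_symbol (quat_alg \<alpha> \<beta>) \<alpha>' \<beta>'" "\<phi> = quad_pfister2 \<beta>' \<alpha>'"
      unfolding norm_form_def by blast
    then have "abs_witt \<phi> = abs_witt (quad_pfister2 \<beta> \<alpha>)"
      using abs_witt_isometric[OF norm_form_quat_alg] by simp
    then show ?thesis by (simp add: abs_witt_quad_pfister2 \<beta>)
  qed
  have cls: "abs_witt \<phi> = pfister2_class a b"
    if a: "a \<noteq> 0" and \<phi>: "\<phi> \<cong>\<^sub>q bilinear_pfister1 a \<otimes>\<^sub>q quad_pfister1 b" for \<phi> and a b :: 'a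
    using abs_witt_isometric[OF \<phi>] abs_witt_quad_pfister2[OF a] by (simp add: quad_pfister2_def)
  note N = norm[OF n(1) \<beta>(1)] norm[OF n(2) \<beta>(2)] norm[OF n(3) \<beta>(3)]
  from common show ?thesis unfolding common_pfister_factor_def \<phi>s
  proof
    assume "\<exists>b. \<forall>\<phi>\<in>set [\<phi>1, \<phi>2, \<phi>3]. \<exists>a. a \<noteq> 0 \<and> \<phi> \<cong>\<^sub>q bilinear_pfister1 a \<otimes>\<^sub>q quad_pfister1 b"
    then obtain b a1 a2 a3 where nz: "a1 \<noteq> 0" "a2 \<noteq> 0" "a3 \<noteq> 0"
      and iso: "\<phi>1 \<cong>\<^sub>q bilinear_pfister1 a1 \<otimes>\<^sub>q quad_pfister1 b"
        "\<phi>2 \<cong>\<^sub>q bilinear_pfister1 a2 \<otimes>\<^sub>q quad_pfister1 b"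
        "\<phi>3 \<cong>\<^sub>q bilinear_pfister1 a3 \<otimes>\<^sub>q quad_pfister1 b" by auto
    show ?thesis unfolding N[symmetric] cls[OF nz(1) iso(1)] cls[OF nz(2) iso(2)] cls[OF nz(3) iso(3)]
      using nz by blast
  next
    assume "\<exists>a. a \<noteq> 0 \<and> (\<forall>\<phi>\<in>set [\<phi>1, \<phi>2, \<phi>3]. \<exists>b. \<phi> \<cong>\<^sub>q bilinear_pfister1 a \<otimes>\<^sub>q quad_pfister1 b)"
    then obtain a b1 b2 b3 where nz: "a \<noteq> 0"
      and iso: "\<phi>1 \<cong>\<^sub>q bilinear_pfister1 a \<otimes>\<^sub>q quad_pfister1 b1"
        "\<phi>2 \<cong>\<^sub>q bilinear_pfister1 a \<otimes>\<^sub>q quad_pfister1 b2"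
        "\<phi>3 \<cong>\<^sub>q bilinear_pfister1 a \<otimes>\<^sub>q quad_pfister1 b3" by auto
    show ?thesis unfolding N[symmetric] cls[OF nz iso(1)] cls[OF nz iso(2)] cls[OF nz iso(3)]
      using nz by blast
  qed
qed

end

section \<open>The unit of the Witt group\<close>

lemma witt_class_cong: "witt_equiv q r \<Longrightarrow> witt_class q = witt_class r"
  unfolding witt_class_def using witt_equiv_sym witt_equiv_trans by blast

lemma nonsingular_zero_form: "nonsingular (zero_form :: 'a::field qform)"
  by (auto simp: nonsingular_def quadratic_form_def polar_def zero_form_def)

lemma one_Iq: "\<one>\<^bsub>Iq\<^esub> = witt_class zero_form"
  by (simp add: Iq_def)

text \<open>The product is a union over representatives; there are some, and all of them yield the
  same class.\<close>

lemma one_Iq_mult: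
  assumes "nonsingular q"
  shows "\<one>\<^bsub>Iq\<^esub> \<otimes>\<^bsub>Iq\<^esub> witt_class q = witt_class q"
proof -
  have "witt_class (p \<bottom>\<^sub>q r) = witt_class q" if "p \<in> witt_class zero_form" "r \<in> witt_class q" for p r
  proof (rule witt_class_cong)
    have "witt_equiv p zero_form" "witt_equiv r q" using that witt_equiv_sym unfolding witt_class_def by auto
    then show "witt_equiv (p \<bottom>\<^sub>q r) q"
      using witt_equiv_trans[OF witt_equiv_orth_sum isometric_witt_equiv[OF orth_sum_zero_left]] by blast
  qed
  moreover have "zero_form \<in> witt_class zero_form" "q \<in> witt_class q"
    using assms nonsingular_zero_form by (auto simp: witt_class_def)
  ultimately have "(\<Union>p \<in> witt_class zero_form. \<Union>r \<in> witt_class q. witt_class (p \<bottom>\<^sub>q r)) = witt_class q"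
    by blast
  then show ?thesis by (simp add: Iq_def)
qed

text \<open>The unit is closed under products by the unit law, which also determines its
  inverse.\<close>

lemma generate_one_Iq: "generate Iq {\<one>\<^bsub>Iq\<^esub>} = {\<one>\<^bsub>Iq :: 'a::field qform set monoid\<^esub>}"
proof -
  let ?G = "Iq :: 'a qform set monoid"
  have one: "\<one>\<^bsub>?G\<^esub> \<otimes>\<^bsub>?G\<^esub> \<one>\<^bsub>?G\<^esub> = \<one>\<^bsub>?G\<^esub>" "\<one>\<^bsub>?G\<^esub> \<in> carrier ?G"
    using one_Iq_mult[OF nonsingular_zero_form, where 'a='a] nonsingular_zero_form
    by (auto simp: one_Iq) (auto simp: Iq_def)
  have mult: "\<one>\<^bsub>?G\<^esub> \<otimes>\<^bsub>?G\<^esub> X = X" if "X \<in> carrier ?G" for X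
    using that one_Iq_mult by (auto simp: Iq_def)
  have inv: "inv\<^bsub>?G\<^esub> \<one>\<^bsub>?G\<^esub> = \<one>\<^bsub>?G\<^esub>"
    unfolding m_inv_def using one mult by (intro the_equality) auto
  have "X = \<one>\<^bsub>?G\<^esub>" if "X \<in> generate ?G {\<one>\<^bsub>?G\<^esub>}" for X
    using that by induction (auto simp: inv one)
  then show ?thesis using generate.one by blast
qed

theorem theorem4p4:
  assumes "CHAR('a::field) = 2"
    and "\<And>Q1 Q2 Q3 :: ('a, 'a vec) module.
      quaternion_algebra Q1 \<Longrightarrow> quaternion_algebra Q2 \<Longrightarrow> quaternion_algebra Q3 \<Longrightarrow>
      linked [Q1, Q2, Q3]"
  shows "(Iq3 :: 'a qform set set) = {\<one>\<^bsub>Iq\<^esub>}"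
proof -
  interpret char_two "TYPE('a)" by standard (rule assms(1))
  have zero: "witt_class (scale_form d (quad_pfister3 a b c)) = \<one>\<^bsub>Iq\<^esub>"
    if "a \<noteq> 0" "b \<noteq> 0" "d \<noteq> 0" for a b c d :: 'a
  proof -
    have "pfister3_class a b c = 0"
      by (rule pfister3_class_zero[OF linked_pfister2_class[OF assms(2)] that(1,2)])
    then have "witt_equiv (quad_pfister3 a b c) zero_form"
      using abs_witt_quad_pfister3[OF that(1,2)] unfolding abs_witt_zero[symmetric] witt.abs_eq_iff[symmetric]
      by simp
    then show ?thesis
      using witt_class_cong witt_equiv_scale_zero that(3) one_Iq by metis
  qed
  have "{witt_class (scale_form d (quad_pfister3 a b c)) |a b c d :: 'a. a \<noteq> 0 \<and> b \<noteq> 0 \<and> d \<noteq> 0} = {\<one>\<^bsub>Iq\<^esub>}"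
    (is "?S = _")
  proof
    show "?S \<subseteq> {\<one>\<^bsub>Iq\<^esub>}" using zero by auto
    \<comment> \<open>The set of generators is nonempty, as the choice a = b = d = 1 shows.\<close>
    show "{\<one>\<^bsub>Iq\<^esub>} \<subseteq> ?S" using zero[of 1 1 1] by force
  qed
  then show ?thesis unfolding Iq3_def using generate_one_Iq by simp
qed

end
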